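(* Consider the deep UFM with $K$ classes, $n$ samples per class, depth $L$ and width $d$, trained by gradient flow $\frac{d\theta}{dt}=-\nabla_\theta\mathcal{L}$ on the cross-entropy loss, with initialization $W_l(0)=\epsilon B_l$ for $l=1,\dots,L$ and $H_1(0)=\epsilon B_0$, where $B_L\in\mathbb{R}^{K\times d}$, $B_l\in\mathbb{R}^{d\times d}$ ($1\le l\le L-1$), $B_0\in\mathbb{R}^{d\times nK}$ have i.i.d. $N(0,1/d)$ entries. Then in the joint limits $\epsilon\to0$ and $d\to\infty$ (with $K,n,L$ fixed), $$\epsilon^{-2L}\,\dot Z(0)\ \to\ (L+1)\,S\otimes 1_n^T\quad\text{in probability},$$ i.e. $\dot Z(0)\to\epsilon^{2L}(L+1)S\otimes1_n^T$, where $\dot Z(0)$ is the time derivative at $t=0$ of the logit matrix $Z(t)=W_L(t)\cdots W_1(t)H_1(t)$.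
   Context: Deep UFM: $W_L\in\mathbb{R}^{K\times d}$, $W_{L-1},\dots,W_1\in\mathbb{R}^{d\times d}$, $H_1\in\mathbb{R}^{d\times nK}$, $Z=W_L\cdots W_1H_1\in\mathbb{R}^{K\times nK}$ with columns $z_{ic}$ ordered by class (column $(c-1)n+i$ for sample $i$ of class $c$), and $\mathcal{L}=-\sum_{c=1}^K\sum_{i=1}^n\log\frac{\exp((z_{ic})_c)}{\sum_{c'}\exp((z_{ic})_{c'})}$. $S=I_K-\frac1K1_K1_K^T$, $1_n$ the all-ones vector, $\otimes$ the Kronecker product. *)

theory Defs
  imports "HOL-Probability.Probability"
begin

(* Parameters theta of the deep UFM are real functions on indices (l,i,j) :: nat*nat*nat.
   Layer index l = 0 encodes H_1 (d x nK), 1 <= l <= L-1 encodes W_l (d x d),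
   l = L encodes W_L (K x d). All indices are 0-based. *)

type_synonym param = "nat \<times> nat \<times> nat \<Rightarrow> real"

definition ufm_params :: "nat \<Rightarrow> nat \<Rightarrow> nat \<Rightarrow> nat \<Rightarrow> (nat \<times> nat \<times> nat) set" where
  "ufm_params K n L d =
     {(l,i,j). (l = 0 \<and> i < d \<and> j < n*K)
             \<or> (1 \<le> l \<and> l < L \<and> i < d \<and> j < d)
             \<or> (l = L \<and> 1 \<le> L \<and> i < K \<and> j < d)}"

fun hprod :: "nat \<Rightarrow> param \<Rightarrow> nat \<Rightarrow> nat \<Rightarrow> nat \<Rightarrow> real" where
  "hprod d \<theta> 0 = (\<lambda>i j. \<theta> (0,i,j))"
| "hprod d \<theta> (Suc l) = (\<lambda>i j. \<Sum>k<d. \<theta> (Suc l,i,k) * hprod d \<theta> l k j)"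

(* logit matrix Z = W_L ... W_1 H_1 (K x nK); column c*n+i is sample i of class c *)
definition logits :: "nat \<Rightarrow> nat \<Rightarrow> param \<Rightarrow> nat \<Rightarrow> nat \<Rightarrow> real" where
  "logits L d \<theta> = hprod d \<theta> L"

definition ce_loss :: "nat \<Rightarrow> nat \<Rightarrow> nat \<Rightarrow> nat \<Rightarrow> param \<Rightarrow> real" where
  "ce_loss K n L d \<theta> =
     - (\<Sum>c<K. \<Sum>i<n. ln (exp (logits L d \<theta> c (c*n+i)) /
                          (\<Sum>c'<K. exp (logits L d \<theta> c' (c*n+i)))))"

definition pderiv_at :: "(param \<Rightarrow> real) \<Rightarrow> param \<Rightarrow> nat \<times> nat \<times> nat \<Rightarrow> real" where
  "pderiv_at f \<theta> p = deriv (\<lambda>s. f (\<theta>(p := s))) (\<theta> p)"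

(* time derivative at t=0 of Z(t) under gradient flow d theta_p/dt = - dL/d theta_p started
   at theta0 (chain rule): Zdot c j = sum_p dZ_{cj}/d theta_p * (- dL/d theta_p) *)
definition Zdot0 :: "nat \<Rightarrow> nat \<Rightarrow> nat \<Rightarrow> nat \<Rightarrow> param \<Rightarrow> nat \<Rightarrow> nat \<Rightarrow> real" where
  "Zdot0 K n L d \<theta>0 c j =
     (\<Sum>p\<in>ufm_params K n L d.
        pderiv_at (\<lambda>\<theta>. logits L d \<theta> c j) \<theta>0 p * (- pderiv_at (ce_loss K n L d) \<theta>0 p))"

(* entries of S \<otimes> 1_n^T, S = I_K - (1/K) 1 1^T *)
definition S_kron :: "nat \<Rightarrow> nat \<Rightarrow> nat \<Rightarrow> nat \<Rightarrow> real" where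
  "S_kron K n c j = (if c = j div n then 1 else 0) - 1 / real K"

definition gauss_init :: "nat \<Rightarrow> nat \<Rightarrow> nat \<Rightarrow> nat \<Rightarrow> param measure" where
  "gauss_init K n L d =
     PiM (ufm_params K n L d) (\<lambda>_. density lborel (normal_density 0 (1 / sqrt (real d))))"

definition dev_event :: "nat \<Rightarrow> nat \<Rightarrow> nat \<Rightarrow> nat \<Rightarrow> real \<Rightarrow> real \<Rightarrow> param set" where
  "dev_event K n L d \<epsilon> \<eta> =
     {B \<in> space (gauss_init K n L d).
        \<exists>c<K. \<exists>j<n*K.
          \<bar>Zdot0 K n L d (\<lambda>p. \<epsilon> * B p) c j / \<epsilon> ^ (2*L) - real (L+1) * S_kron K n c j\<bar> > \<eta>}"

end

theory Submission
  imports Defs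
begin

text \<open>
  Let \<open>\<Theta>\<close> be the neural tangent kernel, i.e. the Gram matrix of the parameter gradients of the
  logits. By the chain rule and multilinearity,
  \<open>Zdot(0) / \<epsilon>\<^sup>2\<^sup>L\<close> is \<open>\<Theta>(B)\<close> applied to the residuals (one-hot minus softmax) at \<open>\<epsilon>B\<close>.
  Layer \<open>l\<close> contributes to \<open>\<Theta>\<close> the product of the Gram matrices of the rows of \<open>W\<^sub>L \<cdots> W\<^sub>l\<^sub>+\<^sub>1\<close>
  and of the columns of \<open>W\<^sub>l\<^sub>-\<^sub>1 \<cdots> H\<^sub>1\<close>. Multiplying vectors by an independent
  \<open>N(0, 1/d)\<close> matrix with \<open>d\<close> rows preserves inner products up to an \<open>L\<^sup>2\<close>-error of order
  \<open>d\<^sup>-\<^sup>1\<^sup>/\<^sup>2\<close>, so all these Gram matrices tend to the identity and \<open>\<Theta>\<close> tends to \<open>L + 1\<close> times the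
  identity. On the same event the logits at \<open>B\<close> are bounded by Cauchy-Schwarz, so those at \<open>\<epsilon>B\<close>
  are \<open>O(\<epsilon>\<^sup>L\<^sup>+\<^sup>1)\<close>, the softmax tends to the uniform distribution, and the residuals tend
  to \<open>S \<otimes> 1\<^sup>T\<close>.
\<close>

section \<open>Gaussian random matrices\<close>

text \<open>Injectivity makes the singleton blocks \<open>{f i}\<close> disjoint, so the
  restrictions to them are independent, and projecting each block to its one coordinate keeps this.
  Serves to pass to one row of a matrix and to rename coordinates.\<close>

lemma (in prob_space) indep_vars_reindex:
  assumes ind: "indep_vars M' X (f ` I)" and inj: "inj_on f I"
  shows "indep_vars (\<lambda>i. M' (f i)) (\<lambda>i. X (f i)) I"
proof -
  have "indep_vars (\<lambda>i. PiM {f i} M') (\<lambda>i \<omega>. restrict (\<lambda>k. X k \<omega>) {f i}) I"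
    by (rule indep_vars_restrict[OF ind])
      (use inj in \<open>auto simp: disjoint_family_on_def inj_on_def\<close>)
  then have "indep_vars (\<lambda>i. M' (f i)) (\<lambda>i \<omega>. (\<lambda>g. g (f i)) (restrict (\<lambda>k. X k \<omega>) {f i})) I"
    by (rule indep_vars_compose2) simp
  then show ?thesis by simp
qed

text \<open>By stability of the normal law \<open>u\<close> is centred Gaussian with variance
  \<open>v\<close>, and the moments are read off from its density.\<close>

lemma (in prob_space) indep_normal_lincomb_moments:
  fixes X :: "'i \<Rightarrow> 'a \<Rightarrow> real" and x :: "'i \<Rightarrow> real"
  assumes fin: "finite C" and ind: "indep_vars (\<lambda>_. borel) X C" and \<sigma>: "0 < \<sigma>"
    and normal: "\<And>c. c \<in> C \<Longrightarrow> distributed M lborel (X c) (normal_density 0 \<sigma>)"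
  defines "u \<equiv> \<lambda>\<omega>. \<Sum>c\<in>C. X c \<omega> * x c" and "v \<equiv> \<sigma>\<^sup>2 * (\<Sum>c\<in>C. (x c)\<^sup>2)"
  shows "integrable M (\<lambda>\<omega>. u \<omega> ^ k)"
    and "expectation (\<lambda>\<omega>. u \<omega> ^ 2) = v"
    and "expectation (\<lambda>\<omega>. u \<omega> ^ 4) = 3 * v\<^sup>2"
proof -
  \<comment> \<open>Zero coefficients are dropped because the sum rule for independent normals asks
    for positive standard deviations. If no coefficient remains, \<open>u\<close> and
    \<open>v\<close> both vanish.\<close>
  define C' where "C' = {c\<in>C. x c \<noteq> 0}"
  have fin': "finite C'" and sub: "C' \<subseteq> C"
    using fin by (auto simp: C'_def)
  have u: "u = (\<lambda>\<omega>. \<Sum>c\<in>C'. x c * X c \<omega>)"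
    unfolding u_def C'_def using fin
    by (auto simp: fun_eq_iff mult.commute intro!: sum.mono_neutral_right)
  have v: "v = (\<Sum>c\<in>C'. (\<bar>x c\<bar> * \<sigma>)\<^sup>2)"
    unfolding v_def sum_distrib_left C'_def using fin
    by (auto simp: power_mult_distrib mult.commute intro!: sum.mono_neutral_right)
  have "integrable M (\<lambda>\<omega>. u \<omega> ^ k) \<and> expectation (\<lambda>\<omega>. u \<omega> ^ 2) = v \<and>
      expectation (\<lambda>\<omega>. u \<omega> ^ 4) = 3 * v\<^sup>2"
  proof (cases "C' = {}")
    case True
    then show ?thesis by (simp add: u v)
  next
    case False
    have D: "distributed M lborel u (normal_density 0 (sqrt v))"
    proof -
      have "distributed M lborel u
          (normal_density (\<Sum>c\<in>C'. 0) (sqrt (\<Sum>c\<in>C'. (\<bar>x c\<bar> * \<sigma>)\<^sup>2)))"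
        unfolding u
      proof (rule sum_indep_normal[OF fin' False])
        show "indep_vars (\<lambda>i. borel) (\<lambda>c \<omega>. x c * X c \<omega>) C'"
          by (rule indep_vars_compose2[OF indep_vars_subset[OF ind sub]]) simp
      next
        fix c assume c: "c \<in> C'"
        then show "0 < \<bar>x c\<bar> * \<sigma>"
          using \<sigma> by (simp add: C'_def)
        show "distributed M lborel (\<lambda>\<omega>. x c * X c \<omega>) (normal_density 0 (\<bar>x c\<bar> * \<sigma>))"
          using normal_density_affine[OF normal \<sigma>, of c "x c" 0] c by (simp add: C'_def)
      qed
      then show ?thesis by (simp add: v)
    qed
    have vpos: "0 < v"
      unfolding v using False fin' \<sigma> by (intro sum_pos) (auto simp: C'_def)
    then have pos: "0 < sqrt v" by simp
    have "integrable M (\<lambda>\<omega>. u \<omega> ^ k)"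
      using distributed_integrable[OF D, of "\<lambda>x. x ^ k"] integrable_normal_moment[OF pos, of 0 k]
      by simp
    moreover have "expectation (\<lambda>\<omega>. u \<omega> ^ 2) = v"
      using distributed_integral[OF D, of "\<lambda>x. x ^ 2"] integral_normal_moment_even[OF pos, of 0 1] vpos
      by simp
    moreover have "expectation (\<lambda>\<omega>. u \<omega> ^ 4) = 3 * v\<^sup>2"
      using distributed_integral[OF D, of "\<lambda>x. x ^ 4"] integral_normal_moment_even[OF pos, of 0 2] vpos
      by (simp add: fact_numeral power2_eq_square)
    ultimately show ?thesis by blast
  qed
  then show "integrable M (\<lambda>\<omega>. u \<omega> ^ k)" "expectation (\<lambda>\<omega>. u \<omega> ^ 2) = v"
    "expectation (\<lambda>\<omega>. u \<omega> ^ 4) = 3 * v\<^sup>2" by blast+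
qed

text \<open>Polarisation reduces the mixed moments of two linear combinations to the pure ones.\<close>

lemma (in prob_space) indep_normal_lincomb_product:
  fixes X :: "'i \<Rightarrow> 'a \<Rightarrow> real" and x y :: "'i \<Rightarrow> real"
  assumes fin: "finite C" and ind: "indep_vars (\<lambda>_. borel) X C" and \<sigma>: "0 < \<sigma>"
    and normal: "\<And>c. c \<in> C \<Longrightarrow> distributed M lborel (X c) (normal_density 0 \<sigma>)"
  defines "w \<equiv> \<lambda>\<omega>. (\<Sum>c\<in>C. X c \<omega> * x c) * (\<Sum>c\<in>C. X c \<omega> * y c)"
  shows "integrable M w"
    and "expectation w = \<sigma>\<^sup>2 * (\<Sum>c\<in>C. x c * y c)"
    and "integrable M (\<lambda>\<omega>. (w \<omega>)\<^sup>2)"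
    and "expectation (\<lambda>\<omega>. (w \<omega>)\<^sup>2)
      \<le> 3 / 2 * \<sigma> ^ 4 * ((\<Sum>c\<in>C. (x c)\<^sup>2)\<^sup>2 + (\<Sum>c\<in>C. (y c)\<^sup>2)\<^sup>2)"
proof -
  let ?u = "\<lambda>z \<omega>. \<Sum>c\<in>C. X c \<omega> * z c"
  note m = indep_normal_lincomb_moments[OF fin ind \<sigma> normal]
  have w: "w = (\<lambda>\<omega>. ((?u (\<lambda>c. x c + y c) \<omega>)^2 - (?u (\<lambda>c. x c - y c) \<omega>)^2) / 4)"
    by (simp add: w_def fun_eq_iff sum.distrib sum_subtractf distrib_left right_diff_distrib
        power2_eq_square algebra_simps)
  show "integrable M w"
    unfolding w by (intro integrable_divide Bochner_Integration.integrable_diff m(1))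
  have "expectation w = (\<sigma>\<^sup>2 * (\<Sum>c\<in>C. (x c + y c)\<^sup>2) - \<sigma>\<^sup>2 * (\<Sum>c\<in>C. (x c - y c)\<^sup>2)) / 4"
    unfolding w by (simp add: m(1) m(2))
  also have "\<dots> = \<sigma>\<^sup>2 * (\<Sum>c\<in>C. ((x c + y c)\<^sup>2 - (x c - y c)\<^sup>2) / 4)"
    by (simp add: sum_subtractf sum_divide_distrib[symmetric] algebra_simps)
  also have "\<dots> = \<sigma>\<^sup>2 * (\<Sum>c\<in>C. x c * y c)"
    by (simp add: power2_eq_square algebra_simps)
  finally show "expectation w = \<sigma>\<^sup>2 * (\<Sum>c\<in>C. x c * y c)" .
  \<comment> \<open>The inequality \<open>2 * a * b \<le> a^2 + b^2\<close>, applied to the squares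
    of the two combinations, leaves only pure fourth moments to bound.\<close>
  have bnd: "(w \<omega>)\<^sup>2 \<le> (?u x \<omega> ^ 4 + ?u y \<omega> ^ 4) / 2" for \<omega>
  proof -
    have "0 \<le> ((?u x \<omega>)\<^sup>2 - (?u y \<omega>)\<^sup>2)\<^sup>2" by simp
    then show ?thesis
      by (simp add: w_def power_mult_distrib power2_diff flip: power_mult)
  qed
  have int4: "integrable M (\<lambda>\<omega>. (?u x \<omega> ^ 4 + ?u y \<omega> ^ 4) / 2)"
    by (intro integrable_divide Bochner_Integration.integrable_add m(1))
  have [measurable]: "w \<in> borel_measurable M"
    using \<open>integrable M w\<close> by simp
  show int: "integrable M (\<lambda>\<omega>. (w \<omega>)\<^sup>2)"
    by (rule Bochner_Integration.integrable_bound[OF int4]) (use bnd in \<open>auto intro: order_trans\<close>)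
  have "expectation (\<lambda>\<omega>. (w \<omega>)\<^sup>2) \<le> expectation (\<lambda>\<omega>. (?u x \<omega> ^ 4 + ?u y \<omega> ^ 4) / 2)"
    by (rule integral_mono[OF int int4 bnd])
  also have "\<dots> = 3 / 2 * \<sigma> ^ 4 * ((\<Sum>c\<in>C. (x c)\<^sup>2)\<^sup>2 + (\<Sum>c\<in>C. (y c)\<^sup>2)\<^sup>2)"
    by (simp add: m(1) m(3) power_mult_distrib distrib_left flip: power_mult)
  finally show "expectation (\<lambda>\<omega>. (w \<omega>)\<^sup>2)
      \<le> 3 / 2 * \<sigma> ^ 4 * ((\<Sum>c\<in>C. (x c)\<^sup>2)\<^sup>2 + (\<Sum>c\<in>C. (y c)\<^sup>2)\<^sup>2)" .
qed

text \<open>\<open>T\<close> is a sum over rows of centred products. Distinct rows are independent,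
  so the cross terms have mean zero, and what remains is the sum of the row variances, each at most
  the second moment of the row product.\<close>

lemma (in prob_space) gaussian_matrix_inner_deviation:
  fixes X :: "'r \<times> 'c \<Rightarrow> 'a \<Rightarrow> real" and x y :: "'c \<Rightarrow> real" and \<sigma> :: real
  assumes finR: "finite R" and finC: "finite C"
    and ind: "indep_vars (\<lambda>_. borel) X (R \<times> C)" and \<sigma>: "0 < \<sigma>"
    and normal: "\<And>p. p \<in> R \<times> C \<Longrightarrow> distributed M lborel (X p) (normal_density 0 \<sigma>)"
  defines "T \<equiv> \<lambda>\<omega>. (\<Sum>r\<in>R. (\<Sum>c\<in>C. X (r, c) \<omega> * x c) * (\<Sum>c\<in>C. X (r, c) \<omega> * y c))
                 - card R * \<sigma>\<^sup>2 * (\<Sum>c\<in>C. x c * y c)"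
  shows "integrable M (\<lambda>\<omega>. (T \<omega>)\<^sup>2)"
    and "expectation (\<lambda>\<omega>. (T \<omega>)\<^sup>2)
      \<le> card R * (3 / 2 * \<sigma> ^ 4 * ((\<Sum>c\<in>C. (x c)\<^sup>2)\<^sup>2 + (\<Sum>c\<in>C. (y c)\<^sup>2)\<^sup>2))"
proof -
  define \<mu> where "\<mu> = \<sigma>\<^sup>2 * (\<Sum>c\<in>C. x c * y c)"
  define w where "w = (\<lambda>r \<omega>. (\<Sum>c\<in>C. X (r, c) \<omega> * x c) * (\<Sum>c\<in>C. X (r, c) \<omega> * y c))"
  define V where "V = 3 / 2 * \<sigma> ^ 4 * ((\<Sum>c\<in>C. (x c)\<^sup>2)\<^sup>2 + (\<Sum>c\<in>C. (y c)\<^sup>2)\<^sup>2)"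
  have indr: "indep_vars (\<lambda>_. borel) (\<lambda>c. X (r, c)) C" if r: "r \<in> R" for r
    by (rule indep_vars_reindex[of _ _ "Pair r", OF indep_vars_subset[OF ind]])
      (use r in \<open>auto simp: inj_on_def\<close>)
  have wm: "integrable M (w r)" "expectation (w r) = \<mu>" "integrable M (\<lambda>\<omega>. (w r \<omega>)\<^sup>2)"
    "expectation (\<lambda>\<omega>. (w r \<omega>)\<^sup>2) \<le> V" if r: "r \<in> R" for r
    using indep_normal_lincomb_product[OF finC indr[OF r] \<sigma> normal, of x y] r
    by (auto simp: w_def \<mu>_def V_def)
  have cov: "integrable M (\<lambda>\<omega>. (w r \<omega> - \<mu>) * (w s \<omega> - \<mu>)) \<and>
      expectation (\<lambda>\<omega>. (w r \<omega> - \<mu>) * (w s \<omega> - \<mu>)) \<le> (if r = s then V else 0)"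
    if r: "r \<in> R" and s: "s \<in> R" for r s
  proof (cases "r = s")
    case True
    have eq: "(w r \<omega> - \<mu>) * (w s \<omega> - \<mu>) = (w r \<omega>)\<^sup>2 - 2 * \<mu> * w r \<omega> + \<mu>\<^sup>2" for \<omega>
      by (simp add: True power2_eq_square algebra_simps)
    have "expectation (\<lambda>\<omega>. (w r \<omega> - \<mu>) * (w s \<omega> - \<mu>))
        = expectation (\<lambda>\<omega>. (w r \<omega>)\<^sup>2) - 2 * \<mu> * \<mu> + \<mu>\<^sup>2"
      unfolding eq using wm[OF r] by (simp add: prob_space)
    also have "\<dots> \<le> V"
      using wm(4)[OF r] by (simp add: power2_eq_square) (smt (verit) zero_le_square)
    finally show ?thesis
      unfolding eq using True wm[OF r] by (simp add: eq)
  next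
    case False
    define g where "g = (\<lambda>r (f :: 'r \<times> 'c \<Rightarrow> real).
        (\<Sum>c\<in>C. f (r, c) * x c) * (\<Sum>c\<in>C. f (r, c) * y c) - \<mu>)"
    have gm: "g r \<in> borel_measurable (PiM ({r} \<times> C) (\<lambda>_. borel))" for r
      unfolding g_def by measurable
    have gw: "g r (restrict (\<lambda>i. X i \<omega>) ({r} \<times> C)) = w r \<omega> - \<mu>" for r \<omega>
      unfolding g_def w_def by simp
    have "indep_var (PiM ({r} \<times> C) (\<lambda>_. borel)) (\<lambda>\<omega>. restrict (\<lambda>i. X i \<omega>) ({r} \<times> C))
        (PiM ({s} \<times> C) (\<lambda>_. borel)) (\<lambda>\<omega>. restrict (\<lambda>i. X i \<omega>) ({s} \<times> C))"
      by (rule indep_var_restrict[OF ind]) (use r s False in auto)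
    from indep_var_compose[OF this gm gm]
    have iv: "indep_var borel (\<lambda>\<omega>. w r \<omega> - \<mu>) borel (\<lambda>\<omega>. w s \<omega> - \<mu>)"
      by (simp add: comp_def gw)
    have i: "integrable M (\<lambda>\<omega>. w r \<omega> - \<mu>)" "integrable M (\<lambda>\<omega>. w s \<omega> - \<mu>)"
      using wm(1) r s by auto
    show ?thesis
      using indep_var_lebesgue_integral[OF iv i] indep_var_integrable[OF iv i] wm[OF r] False
      by (simp add: prob_space)
  qed
  have T: "T \<omega> = (\<Sum>r\<in>R. w r \<omega> - \<mu>)" for \<omega>
    by (simp add: T_def w_def \<mu>_def sum_subtractf)
  have T2: "(T \<omega>)\<^sup>2 = (\<Sum>r\<in>R. \<Sum>s\<in>R. (w r \<omega> - \<mu>) * (w s \<omega> - \<mu>))" for \<omega>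
    unfolding T power2_eq_square by (rule sum_product)
  show "integrable M (\<lambda>\<omega>. (T \<omega>)\<^sup>2)"
    unfolding T2 by (intro Bochner_Integration.integrable_sum) (use cov in auto)
  have "expectation (\<lambda>\<omega>. (T \<omega>)\<^sup>2)
      = (\<Sum>r\<in>R. \<Sum>s\<in>R. expectation (\<lambda>\<omega>. (w r \<omega> - \<mu>) * (w s \<omega> - \<mu>)))"
    unfolding T2 using cov
    by (subst Bochner_Integration.integral_sum;
        (intro Bochner_Integration.integrable_sum sum.cong Bochner_Integration.integral_sum refl)?) auto
  also have "\<dots> \<le> (\<Sum>r\<in>R. \<Sum>s\<in>R. if r = s then V else 0)"
    using cov by (intro sum_mono) auto
  also have "\<dots> = card R * V"
    using finR by (simp add: sum.delta)
  finally show "expectation (\<lambda>\<omega>. (T \<omega>)\<^sup>2)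
      \<le> card R * (3 / 2 * \<sigma> ^ 4 * ((\<Sum>c\<in>C. (x c)\<^sup>2)\<^sup>2 + (\<Sum>c\<in>C. (y c)\<^sup>2)\<^sup>2))"
    by (simp add: V_def)
qed

text \<open>The tuple of all coordinates has the product measure itself as its law, and this is the
  product of the marginals, which is independence.\<close>

lemma PiM_normal_coordinates:
  fixes \<sigma> :: real and J :: "'i set"
  assumes \<sigma>: "0 < \<sigma>"
  defines "M \<equiv> PiM J (\<lambda>_. density lborel (normal_density 0 \<sigma>))"
  shows "prob_space M"
    and "prob_space.indep_vars M (\<lambda>_. borel) (\<lambda>i B. B i) J"
    and "\<And>i. i \<in> J \<Longrightarrow> distributed M lborel (\<lambda>B. B i) (normal_density 0 \<sigma>)"
proof -
  let ?G = "density lborel (normal_density 0 \<sigma>)"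
  have G: "prob_space ?G"
    by (rule prob_space_normal_density[OF \<sigma>])
  have sets: "sets M = sets (PiM J (\<lambda>_. borel))"
    unfolding M_def by (rule sets_PiM_cong) auto
  show M: "prob_space M"
    unfolding M_def by (rule prob_space_PiM) (rule G)
  then interpret M: prob_space M .
  have rv: "(\<lambda>B. B i) \<in> borel_measurable M" if "i \<in> J" for i
    using that by (simp add: measurable_cong_sets[OF sets refl])
  have comp: "distr M borel (\<lambda>B. B i) = ?G" if "i \<in> J" for i
  proof -
    have "distr M borel (\<lambda>B. B i) = distr M ?G (\<lambda>B. B i)"
      by (rule distr_cong) auto
    also have "\<dots> = ?G"
      unfolding M_def using G that by (intro distr_PiM_component) auto
    finally show ?thesis .
  qed
  show "M.indep_vars (\<lambda>_. borel) (\<lambda>i B. B i) J"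
  \<comment> \<open>The characterisation of independence by the joint law asks for a nonempty index
    set.\<close>
  proof (cases "J = {}")
    case True
    then show ?thesis
      by (simp add: M.indep_vars_def M.indep_sets_def)
  next
    case False
    have "distr M (PiM J (\<lambda>_. borel)) (\<lambda>B. \<lambda>i\<in>J. B i) = distr M M (\<lambda>B. B)"
      using sets by (intro distr_cong)
        (auto simp: M_def space_PiM PiE_def extensional_def fun_eq_iff)
    also have "\<dots> = PiM J (\<lambda>i. distr M borel (\<lambda>B. B i))"
      unfolding distr_id[unfolded id_def] by (subst M_def, rule PiM_cong) (auto simp: comp)
    finally show ?thesis
      using M.indep_vars_iff_distr_eq_PiM'[where I = J and M' = "\<lambda>_. borel" and X = "\<lambda>i B. B i"] False rv by simp
  qed
  show "distributed M lborel (\<lambda>B. B i) (normal_density 0 \<sigma>)" if "i \<in> J" for i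
    unfolding distributed_def using rv[OF that] comp[OF that]
    by (auto simp: distr_cong[OF refl sets_lborel refl])
qed

text \<open>With variance \<open>1 / card R\<close> the rows together reproduce the inner product in
  mean, and the error bound is of order \<open>1 / card R\<close>. The measure lives on exactly the
  entries of one matrix, so that it can be the inner integral in Fubini's theorem.\<close>

lemma nn_integral_gaussian_matrix_inner_deviation:
  fixes q :: "'r \<Rightarrow> 'c \<Rightarrow> 'i" and x y :: "'c \<Rightarrow> real"
  assumes fin: "finite R" "finite C" and R: "R \<noteq> {}"
    and inj: "inj_on (\<lambda>(r, c). q r c) (R \<times> C)"
  shows "(\<integral>\<^sup>+ B. ennreal (((\<Sum>r\<in>R. (\<Sum>c\<in>C. B (q r c) * x c) * (\<Sum>c\<in>C. B (q r c) * y c))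
              - (\<Sum>c\<in>C. x c * y c))\<^sup>2)
            \<partial>PiM ((\<lambda>(r, c). q r c) ` (R \<times> C))
                (\<lambda>_. density lborel (normal_density 0 (1 / sqrt (card R)))))
    \<le> ennreal (3 / (2 * card R) * ((\<Sum>c\<in>C. (x c)\<^sup>2)\<^sup>2 + (\<Sum>c\<in>C. (y c)\<^sup>2)\<^sup>2))"
proof -
  define \<sigma> where "\<sigma> = 1 / sqrt (card R)"
  let ?J = "(\<lambda>(r, c). q r c) ` (R \<times> C)"
  let ?M = "PiM ?J (\<lambda>_. density lborel (normal_density 0 \<sigma>))"
  have pos: "0 < card R"
    using fin R by (simp add: card_gt_0_iff)
  then have \<sigma>: "0 < \<sigma>" and \<sigma>2: "card R * \<sigma>\<^sup>2 = 1" 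
    by (auto simp: \<sigma>_def power_divide)
  have \<sigma>4: "card R * (3 / 2 * \<sigma> ^ 4 * t) = 3 / (2 * card R) * t" for t
  proof -
    have "\<sigma> ^ 4 = (\<sigma>\<^sup>2)\<^sup>2" by simp
    also have "\<dots> = 1 / (card R)\<^sup>2"
      using pos by (simp add: \<sigma>_def power_divide)
    finally show ?thesis
      using pos by (simp add: power2_eq_square)
  qed
  note c = PiM_normal_coordinates[OF \<sigma>, where J = ?J]
  interpret prob_space ?M by (rule c(1))
  have ind: "indep_vars (\<lambda>_. borel) (\<lambda>p B. B (case p of (r, c) \<Rightarrow> q r c)) (R \<times> C)"
    using indep_vars_reindex[OF c(2) inj] by (simp add: case_prod_unfold)
  have norm: "distributed ?M lborel (\<lambda>B. B (case p of (r, c) \<Rightarrow> q r c)) (normal_density 0 \<sigma>)"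
    if "p \<in> R \<times> C" for p
    using c(3)[of "case p of (r, c) \<Rightarrow> q r c"] that by auto
  note dev = gaussian_matrix_inner_deviation[OF fin ind \<sigma> norm, of x y, simplified \<sigma>2 \<sigma>4]
  show ?thesis
    unfolding \<sigma>_def[symmetric]
    using dev by (subst nn_integral_eq_integral) (auto intro!: ennreal_leI)
qed

section \<open>Gram matrices of products of Gaussian matrices\<close>

text \<open>A triangle inequality for squared \<open>L^2\<close> norms that avoids square roots,
  from \<open>(a + b)^2 \<le> 2 * a^2 + 2 * b^2\<close>.\<close>

lemma nn_integral_square_add_le:
  fixes a b :: "'a \<Rightarrow> real"
  assumes [measurable]: "a \<in> borel_measurable M" "b \<in> borel_measurable M"
    and "(\<integral>\<^sup>+ B. ennreal ((a B)\<^sup>2) \<partial>M) \<le> ennreal u" "(\<integral>\<^sup>+ B. ennreal ((b B)\<^sup>2) \<partial>M) \<le> ennreal v"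
    and "0 \<le> u" "0 \<le> v"
  shows "(\<integral>\<^sup>+ B. ennreal ((a B + b B)\<^sup>2) \<partial>M) \<le> ennreal (2 * u + 2 * v)"
proof -
  have "(a B + b B)\<^sup>2 \<le> 2 * (a B)\<^sup>2 + 2 * (b B)\<^sup>2" for B
    using sum_squares_bound[of "a B" "b B"] by (simp add: power2_sum)
  then have "(\<integral>\<^sup>+ B. ennreal ((a B + b B)\<^sup>2) \<partial>M)
      \<le> (\<integral>\<^sup>+ B. 2 * ennreal ((a B)\<^sup>2) + 2 * ennreal ((b B)\<^sup>2) \<partial>M)"
    by (intro nn_integral_mono) (simp flip: ennreal_plus ennreal_mult'' ennreal_numeral)
  also have "\<dots> = 2 * (\<integral>\<^sup>+ B. ennreal ((a B)\<^sup>2) \<partial>M) + 2 * (\<integral>\<^sup>+ B. ennreal ((b B)\<^sup>2) \<partial>M)"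
    by (simp add: nn_integral_add nn_integral_cmult)
  also have "\<dots> \<le> 2 * ennreal u + 2 * ennreal v"
    using assms by (intro add_mono mult_left_mono) auto
  also have "\<dots> = ennreal (2 * u + 2 * v)"
    using assms by (simp flip: ennreal_plus ennreal_mult'' ennreal_numeral)
  finally show ?thesis .
qed

text \<open>\<open>chain p N B j s\<close> is the unit vector \<open>e\<^sub>j\<close> multiplied by \<open>s\<close> matrices; the matrix of step \<open>s\<close> has
  \<open>N s\<close> columns and its entries are read off \<open>B\<close> through the index map \<open>p s\<close>.\<close>

fun chain :: "(nat \<Rightarrow> nat \<Rightarrow> nat \<Rightarrow> 'i) \<Rightarrow> (nat \<Rightarrow> nat) \<Rightarrow> ('i \<Rightarrow> real) \<Rightarrow> nat \<Rightarrow> nat \<Rightarrow> nat \<Rightarrow> real"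
  where
    "chain p N B j 0 r = of_bool (r = j)"
  | "chain p N B j (Suc s) r = (\<Sum>c<N s. B (p s r c) * chain p N B j s c)"

definition gram ::
    "(nat \<Rightarrow> nat \<Rightarrow> nat \<Rightarrow> 'i) \<Rightarrow> (nat \<Rightarrow> nat) \<Rightarrow> ('i \<Rightarrow> real) \<Rightarrow> nat \<Rightarrow> nat \<Rightarrow> nat \<Rightarrow> real"
  where "gram p N B s i j = (\<Sum>r<N s. chain p N B i s r * chain p N B j s r)"

text \<open>A chain of length \<open>s\<close> reads only the matrices of the steps below
  \<open>s\<close>. Hence it does not depend on the next matrix, and changing an entry of a later
  step leaves it alone.\<close>

lemma chain_cong:
  assumes "r < N s"
    and "\<And>t r c. t < s \<Longrightarrow> r < N (Suc t) \<Longrightarrow> c < N t \<Longrightarrow> B (p t r c) = B' (p t r c)"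
  shows "chain p N B j s r = chain p N B' j s r"
  using assms
proof (induction s arbitrary: r)
  case (Suc s)
  then show ?case by (auto intro!: sum.cong)
qed simp

lemma gram_cong:
  assumes "\<And>t r c. t < s \<Longrightarrow> r < N (Suc t) \<Longrightarrow> c < N t \<Longrightarrow> B (p t r c) = B' (p t r c)"
  shows "gram p N B s i j = gram p N B' s i j"
  unfolding gram_def
  by (intro sum.cong refl arg_cong2[of _ _ _ _ "(*)"] chain_cong) (use assms in auto)

lemma chain_scale: "chain p N (\<lambda>i. a * B i) j s r = a ^ s * chain p N B j s r"
  by (induction s arbitrary: r) (auto simp: sum_distrib_left algebra_simps)

lemma gram_scale: "gram p N (\<lambda>i. a * B i) s i j = a ^ (2 * s) * gram p N B s i j"
  by (simp add: gram_def chain_scale sum_distrib_left power_mult power2_eq_square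
      power_mult_distrib algebra_simps)

definition gaussian_entry :: "nat \<Rightarrow> real measure" where
  "gaussian_entry d = density lborel (normal_density 0 (1 / sqrt (real d)))"

text \<open>Covers both directions through the network: products read from the input side and
  transposed products read from the output side. The steps below \<open>m\<close> are those whose
  matrices have \<open>d\<close> rows and read entries in \<open>I\<close>; \<open>p_inj\<close>
  makes all these entries distinct coordinates, hence independent.\<close>

locale gaussian_chain =
  fixes p :: "nat \<Rightarrow> nat \<Rightarrow> nat \<Rightarrow> 'i" and N :: "nat \<Rightarrow> nat" and I :: "'i set" and m d :: nat
  assumes finite_I: "finite I" and d_pos: "0 < d" and N_Suc: "\<And>s. N (Suc s) = d"
    and p_in: "\<And>s r c. s < m \<Longrightarrow> r < d \<Longrightarrow> c < N s \<Longrightarrow> p s r c \<in> I"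
    and p_inj: "\<And>s r c s' r' c'. p s r c = p s' r' c' \<Longrightarrow> s < m \<Longrightarrow> s' < m \<Longrightarrow>
      s = s' \<and> r = r' \<and> c = c'"
begin

abbreviation G :: "real measure" where "G \<equiv> gaussian_entry d"

abbreviation P :: "('i \<Rightarrow> real) measure" where "P \<equiv> PiM I (\<lambda>_. G)"

lemma prob_space_PiM_G: "prob_space (PiM J (\<lambda>_. G))"
  unfolding gaussian_entry_def using d_pos by (intro PiM_normal_coordinates(1)) simp

sublocale G: product_sigma_finite "\<lambda>_. G"
proof (rule product_sigma_finite.intro)
  have "prob_space G"
    unfolding gaussian_entry_def using d_pos by (intro prob_space_normal_density) simp
  then show "sigma_finite_measure G"
    by (simp add: prob_space_imp_sigma_finite)
qed

lemma borel_measurable_coordinate: "i \<in> J \<Longrightarrow> (\<lambda>B. B i) \<in> borel_measurable (PiM J (\<lambda>_. G))"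
  using measurable_component_singleton[of i J "\<lambda>_. G"]
  by (simp add: gaussian_entry_def cong: measurable_cong_sets)

lemma borel_measurable_chain:
  assumes "s \<le> m" "r < N s"
    and "\<And>t r c. t < s \<Longrightarrow> r < d \<Longrightarrow> c < N t \<Longrightarrow> p t r c \<in> J"
  shows "(\<lambda>B. chain p N B j s r) \<in> borel_measurable (PiM J (\<lambda>_. G))"
  using assms
proof (induction s arbitrary: r)
  case (Suc s)
  then show ?case
    unfolding chain.simps
    by (intro borel_measurable_sum borel_measurable_times borel_measurable_coordinate)
      (auto simp: N_Suc)
qed simp

lemma borel_measurable_gram:
  assumes "s \<le> m" and "\<And>t r c. t < s \<Longrightarrow> r < d \<Longrightarrow> c < N t \<Longrightarrow> p t r c \<in> J"
  shows "(\<lambda>B. gram p N B s i j) \<in> borel_measurable (PiM J (\<lambda>_. G))"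
  unfolding gram_def
  by (intro borel_measurable_sum borel_measurable_times borel_measurable_chain)
    (use assms in auto)

text \<open>Fubini: the entries \<open>J\<close> of the step-\<open>s\<close> matrix are integrated
  first, with all other coordinates fixed. The two chain vectors are then constants, and the
  one-matrix estimate applies to them.\<close>

lemma gram_step:
  assumes s: "s < m"
  shows "(\<integral>\<^sup>+ B. ennreal ((gram p N B (Suc s) i j - gram p N B s i j)\<^sup>2) \<partial>P)
    \<le> (\<integral>\<^sup>+ B. ennreal (3 / (2 * d) * ((gram p N B s i i)\<^sup>2 + (gram p N B s j j)\<^sup>2)) \<partial>P)"
proof -
  define J where "J = (\<lambda>(r, c). p s r c) ` ({..<d} \<times> {..<N s})"
  define I' where "I' = I - J"
  have J: "finite J" "J \<subseteq> I"
    using p_in s by (auto simp: J_def)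
  have I: "I = I' \<union> J" "I' \<inter> J = {}" "finite I'"
    using J finite_I by (auto simp: I'_def)
  \<comment> \<open>By \<open>p_inj\<close> no earlier step shares an entry with step
    \<open>s\<close>, so the vectors at stage \<open>s\<close> depend only on the coordinates in
    \<open>I'\<close>.\<close>
  have lower: "p t r c \<in> I'" if "t < s" "r < d" "c < N t" for t r c
    using that s p_in[of t r c] p_inj[of t r c s] by (auto simp: I'_def J_def)
  have same: "merge I' J (x, y) (p t r c) = x (p t r c)" if "t < s" "r < d" "c < N t" for t r c x y
    using lower[OF that] by (simp add: merge_def)
  have chain_merge: "chain p N (merge I' J (x, y)) k s c = chain p N x k s c" if "c < N s" for x y k c
    using that same by (intro chain_cong) (auto simp: N_Suc)
  have gram_merge: "gram p N (merge I' J (x, y)) s k l = gram p N x s k l" for x y k l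
    using same by (intro gram_cong) (auto simp: N_Suc)
  have top: "merge I' J (x, y) (p s r c) = y (p s r c)" if "r < d" "c < N s" for x y r c
    using that I(2) by (force simp: merge_def J_def)
  have [measurable]: "(\<lambda>B. gram p N B t k l) \<in> borel_measurable P" if "t \<le> Suc s" for t k l
    using that s p_in by (intro borel_measurable_gram) auto
  let ?f = "\<lambda>B. ennreal ((gram p N B (Suc s) i j - gram p N B s i j)\<^sup>2)"
  let ?g = "\<lambda>B. ennreal (3 / (2 * d) * ((gram p N B s i i)\<^sup>2 + (gram p N B s j j)\<^sup>2))"
  have f: "?f \<in> borel_measurable (PiM (I' \<union> J) (\<lambda>_. G))"
    and g: "?g \<in> borel_measurable (PiM (I' \<union> J) (\<lambda>_. G))"
    unfolding I(1)[symmetric] by measurable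
  have "integral\<^sup>N P ?f
      = (\<integral>\<^sup>+ x. \<integral>\<^sup>+ y. ?f (merge I' J (x, y)) \<partial>PiM J (\<lambda>_. G) \<partial>PiM I' (\<lambda>_. G))"
    by (subst I(1)) (rule G.product_nn_integral_fold[OF I(2,3) J(1) f])
  also have "\<dots> \<le> (\<integral>\<^sup>+ x. ?g x \<partial>PiM I' (\<lambda>_. G))"
  proof (rule nn_integral_mono)
    fix x
    let ?x = "\<lambda>k. chain p N x k s"
    have "?f (merge I' J (x, y)) = ennreal (((\<Sum>r<d. (\<Sum>c<N s. y (p s r c) * ?x i c)
        * (\<Sum>c<N s. y (p s r c) * ?x j c)) - (\<Sum>c<N s. ?x i c * ?x j c))\<^sup>2)" for y
      unfolding gram_merge unfolding gram_def
      by (simp add: N_Suc chain_merge top)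
    then have "(\<integral>\<^sup>+ y. ?f (merge I' J (x, y)) \<partial>PiM J (\<lambda>_. G))
        \<le> ennreal (3 / (2 * d) * ((\<Sum>c<N s. (?x i c)\<^sup>2)\<^sup>2 + (\<Sum>c<N s. (?x j c)\<^sup>2)\<^sup>2))"
      using nn_integral_gaussian_matrix_inner_deviation[of "{..<d}" "{..<N s}" "p s" "?x i" "?x j"]
        d_pos p_inj s by (auto simp: J_def gaussian_entry_def inj_on_def lessThan_empty_iff)
    also have "\<dots> = ?g x"
      by (simp add: gram_def power2_eq_square)
    finally show "(\<integral>\<^sup>+ y. ?f (merge I' J (x, y)) \<partial>PiM J (\<lambda>_. G)) \<le> ?g x" .
  qed
  \<comment> \<open>The integrand is constant in \<open>y\<close> and the inner measure has mass
    one, so the integral over \<open>J\<close> can be put back in before refolding to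
    \<open>P\<close>.\<close>
  also have "\<dots> = (\<integral>\<^sup>+ x. \<integral>\<^sup>+ y. ?g (merge I' J (x, y)) \<partial>PiM J (\<lambda>_. G) \<partial>PiM I' (\<lambda>_. G))"
    unfolding gram_merge by (simp add: prob_space.emeasure_space_1[OF prob_space_PiM_G])
  also have "\<dots> = integral\<^sup>N P ?g"
    by (subst I(1)) (rule G.product_nn_integral_fold[OF I(2,3) J(1) g, symmetric])
  finally show ?thesis .
qed

lemma gram_increment_le:
  assumes s: "s < m"
    and "\<And>k. k \<in> {i, j} \<Longrightarrow> (\<integral>\<^sup>+ B. ennreal ((gram p N B s k k)\<^sup>2) \<partial>P) \<le> ennreal (8 ^ s)"
  shows "(\<integral>\<^sup>+ B. ennreal ((gram p N B (Suc s) i j - gram p N B s i j)\<^sup>2) \<partial>P)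
    \<le> ennreal (3 * 8 ^ s / d)"
proof -
  have [measurable]: "(\<lambda>B. gram p N B s k k) \<in> borel_measurable P" for k
    using s p_in by (intro borel_measurable_gram) auto
  note gram_step[OF s]
  also have "(\<integral>\<^sup>+ B. ennreal (3 / (2 * d) * ((gram p N B s i i)\<^sup>2 + (gram p N B s j j)\<^sup>2)) \<partial>P)
      = ennreal (3 / (2 * d)) * ((\<integral>\<^sup>+ B. ennreal ((gram p N B s i i)\<^sup>2) \<partial>P)
          + (\<integral>\<^sup>+ B. ennreal ((gram p N B s j j)\<^sup>2) \<partial>P))"
    by (subst ennreal_mult'') (auto simp: nn_integral_add nn_integral_cmult simp del: distrib_left_numeral)
  also have "\<dots> \<le> ennreal (3 / (2 * d)) * (ennreal (8 ^ s) + ennreal (8 ^ s))"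
    using assms(2) by (intro mult_left_mono add_mono) auto
  also have "\<dots> = ennreal (3 * 8 ^ s / d)"
    by (simp flip: ennreal_plus ennreal_mult)
  finally show ?thesis .
qed

lemma gram_0: "i < N 0 \<Longrightarrow> gram p N B 0 i j = of_bool (i = j)"
  by (simp add: gram_def of_bool_def if_distrib[of "\<lambda>x. x * _"] sum.delta cong: if_cong)

text \<open>One step multiplies the bound by at most \<open>2 * 3 / d + 2\<close>, which is at most
  8 since \<open>d \<ge> 1\<close>. The resulting bound is uniform in \<open>d\<close>, which makes
  every Gram increment of order \<open>1 / d\<close> in squared \<open>L^2\<close> norm.\<close>

lemma gram_diag_second_moment:
  assumes "i < N 0" "s \<le> m"
  shows "(\<integral>\<^sup>+ B. ennreal ((gram p N B s i i)\<^sup>2) \<partial>P) \<le> ennreal (8 ^ s)"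
  using \<open>s \<le> m\<close>
proof (induction s)
  case 0
  then show ?case
    using assms prob_space.emeasure_space_1[OF prob_space_PiM_G[of I]] by (simp add: gram_0)
next
  case (Suc s)
  have [measurable]: "(\<lambda>B. gram p N B t i i) \<in> borel_measurable P" if "t \<le> m" for t
    using that p_in by (intro borel_measurable_gram) auto
  have "(\<integral>\<^sup>+ B. ennreal (((gram p N B (Suc s) i i - gram p N B s i i) + gram p N B s i i)\<^sup>2) \<partial>P)
      \<le> ennreal (2 * (3 * 8 ^ s / d) + 2 * 8 ^ s)"
    using Suc by (intro nn_integral_square_add_le gram_increment_le) auto
  also have "\<dots> \<le> ennreal (8 ^ Suc s)"
    using d_pos by (intro ennreal_leI) (simp add: field_simps)
  finally show ?case by simp
qed

text \<open>Unit vectors start with deviation zero, each step adds an increment of size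
  \<open>3 * 8 ^ s / d\<close>, and \<open>2 * 3 + 2 = 8\<close> closes the induction.\<close>

lemma gram_deviation:
  assumes "i < N 0" "j < N 0" "s \<le> m"
  shows "(\<integral>\<^sup>+ B. ennreal ((gram p N B s i j - of_bool (i = j))\<^sup>2) \<partial>P) \<le> ennreal (8 ^ s / d)"
  using \<open>s \<le> m\<close>
proof (induction s)
  case 0
  then show ?case
    using assms by (simp add: gram_0)
next
  case (Suc s)
  have [measurable]: "(\<lambda>B. gram p N B t i j) \<in> borel_measurable P" if "t \<le> m" for t
    using that p_in by (intro borel_measurable_gram) auto
  have "(\<integral>\<^sup>+ B. ennreal (((gram p N B (Suc s) i j - gram p N B s i j)
        + (gram p N B s i j - of_bool (i = j)))\<^sup>2) \<partial>P)
      \<le> ennreal (2 * (3 * 8 ^ s / d) + 2 * (8 ^ s / d))"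
    using Suc assms by (intro nn_integral_square_add_le gram_increment_le gram_diag_second_moment) auto
  also have "\<dots> = ennreal (8 ^ Suc s / d)"
    by (simp add: field_simps)
  finally show ?case by simp
qed

text \<open>Chebyshev's inequality: Markov's inequality for the squared deviation.\<close>

lemma gram_concentration:
  fixes \<delta> :: real
  assumes "i < N 0" "j < N 0" "s \<le> m" and \<delta>: "0 < \<delta>"
  shows "{B \<in> space P. \<bar>gram p N B s i j - of_bool (i = j)\<bar> > \<delta>} \<in> sets P"
    and "measure P {B \<in> space P. \<bar>gram p N B s i j - of_bool (i = j)\<bar> > \<delta>} \<le> 8 ^ s / (d * \<delta>\<^sup>2)"
proof -
  have [measurable]: "(\<lambda>B. gram p N B s i j) \<in> borel_measurable P"
    using assms p_in by (intro borel_measurable_gram) auto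
  interpret P: prob_space P by (rule prob_space_PiM_G)
  let ?h = "\<lambda>B. (gram p N B s i j - of_bool (i = j))\<^sup>2"
  let ?A = "{B \<in> space P. \<bar>gram p N B s i j - of_bool (i = j)\<bar> > \<delta>}"
  show "?A \<in> sets P" by measurable
  have *: "1 \<le> ennreal (1 / \<delta>\<^sup>2) * ennreal (?h B)" if "B \<in> ?A" for B
  proof -
    have "\<delta>\<^sup>2 \<le> ?h B"
      using that \<delta> by (simp add: abs_le_square_iff[symmetric])
    then show ?thesis
      using \<delta> by (simp flip: ennreal_mult ennreal_1)
  qed
  have "emeasure P ?A \<le> emeasure P {B \<in> space P. 1 \<le> ennreal (1 / \<delta>\<^sup>2) * ennreal (?h B)}"
    using * by (intro emeasure_mono) auto
  also have "\<dots> \<le> ennreal (1 / \<delta>\<^sup>2) * (\<integral>\<^sup>+ B. ennreal (?h B) * indicator (space P) B \<partial>P)"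
    using nn_integral_Markov_inequality[where u = "\<lambda>B. ennreal (?h B)" and M = P
        and A = "space P" and c = "ennreal (1 / \<delta>\<^sup>2)"]
    by simp
  also have "\<dots> \<le> ennreal (1 / \<delta>\<^sup>2) * ennreal (8 ^ s / d)"
    using gram_deviation[OF assms(1-3)]
    by (intro mult_left_mono) (auto cong: nn_integral_cong)
  also have "\<dots> = ennreal (8 ^ s / (d * \<delta>\<^sup>2))"
    by (simp flip: ennreal_mult add: mult.commute)
  finally show "measure P ?A \<le> 8 ^ s / (d * \<delta>\<^sup>2)"
    using d_pos \<delta> by (simp add: P.emeasure_eq_measure)
qed

end

section \<open>Gradient flow of the deep UFM at initialization\<close>

text \<open>The blocks of \<open>n\<close> consecutive columns tile the index range, and division by
  \<open>n\<close> is constantly \<open>c\<close> on block \<open>c\<close>.\<close>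

lemma sum_class_samples:
  fixes f :: "nat \<Rightarrow> nat \<Rightarrow> 'a :: comm_monoid_add"
  shows "(\<Sum>c<K. \<Sum>i<n. f c (c * n + i)) = (\<Sum>j<n * K. f (j div n) j)"
proof -
  have "(\<Sum>c<K. \<Sum>i<n. f c (c * n + i)) = (\<Sum>c<K. \<Sum>j\<in>{c * n..<c * n + n}. f (j div n) j)"
  proof (rule sum.cong[OF refl])
    fix c
    have "(\<Sum>j\<in>{c * n..<c * n + n}. f (j div n) j)
        = (\<Sum>i\<in>{0..<n}. f ((i + c * n) div n) (i + c * n))"
      using sum.shift_bounds_nat_ivl[of "\<lambda>j. f (j div n) j" 0 "c * n" n] by (simp add: add.commute)
    also have "\<dots> = (\<Sum>i<n. f c (c * n + i))"
      by (rule sum.cong) (auto simp: add.commute)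
    finally show "(\<Sum>i<n. f c (c * n + i)) = (\<Sum>j\<in>{c * n..<c * n + n}. f (j div n) j)" ..
  qed
  also have "\<dots> = (\<Sum>j<n * K. f (j div n) j)"
    by (simp add: sum.nat_group mult.commute)
  finally show ?thesis .
qed

section \<open>Softmax and the derivative of the cross-entropy loss\<close>

definition softmax :: "nat \<Rightarrow> (nat \<Rightarrow> real) \<Rightarrow> nat \<Rightarrow> real" where
  "softmax K z c = exp (z c) / (\<Sum>k<K. exp (z k))"

lemma softmax_bounds:
  assumes "c < K"
  shows "0 \<le> softmax K z c" "softmax K z c \<le> 1"
proof -
  have "exp (z c) \<le> (\<Sum>k<K. exp (z k))"
    using assms by (intro member_le_sum) auto
  moreover have "0 < exp (z c)" by simp
  moreover have "0 < (\<Sum>k<K. exp (z k))"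
    using calculation by linarith
  ultimately show "0 \<le> softmax K z c" "softmax K z c \<le> 1"
    unfolding softmax_def by (auto simp: divide_le_eq_1)
qed

text \<open>Every exponential lies between \<open>exp (- t)\<close> and \<open>exp t\<close>, so the
  quotient lies between \<open>exp (- (2 * t)) / K\<close> and
  \<open>exp (2 * t) / K\<close>.\<close>

lemma softmax_near_uniform:
  assumes K: "1 \<le> K" and c: "c < K" and t: "0 \<le> t" and z: "\<And>k. k < K \<Longrightarrow> \<bar>z k\<bar> \<le> t"
  shows "\<bar>softmax K z c - 1 / K\<bar> \<le> exp (2 * t) - 1"
proof -
  have z': "- t \<le> z k" "z k \<le> t" if "k < K" for k
    using z[OF that] by auto
  have lo: "K * exp (- t) \<le> (\<Sum>k<K. exp (z k))"
    using sum_bounded_below[of "{..<K}" "exp (- t)" "\<lambda>k. exp (z k)"] z' by simp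
  have hi: "(\<Sum>k<K. exp (z k)) \<le> K * exp t"
    using sum_bounded_above[of "{..<K}" "\<lambda>k. exp (z k)" "exp t"] z' by simp
  have pos: "0 < K * exp (- t)" 
    using K by simp
  have "softmax K z c \<le> exp t / (K * exp (- t))"
    unfolding softmax_def using lo pos z[OF c] by (intro frac_le) (auto simp: abs_le_iff)
  also have "\<dots> = exp (2 * t) / K"
    by (simp add: exp_minus field_simps mult_exp_exp)
  finally have 1: "softmax K z c - 1 / K \<le> (exp (2 * t) - 1) / K"
    by (simp add: diff_divide_distrib)
  have "exp (- t) / (K * exp t) \<le> softmax K z c"
    unfolding softmax_def using lo pos hi z[OF c] by (intro frac_le) (auto simp: abs_le_iff)
  moreover have "exp (- t) / (K * exp t) = exp (- (2 * t)) / K"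
    by (simp add: exp_minus field_simps mult_exp_exp)
  ultimately have 2: "1 / K - softmax K z c \<le> (1 - exp (- (2 * t))) / K"
    by (simp add: diff_divide_distrib)
  \<comment> \<open>The lower deviation is dominated by the upper one through
    \<open>1 - exp (- x) \<le> x \<le> exp x - 1\<close> at \<open>x = 2 * t\<close>.\<close>
  have "1 - exp (- (2 * t)) \<le> 2 * t" "2 * t \<le> exp (2 * t) - 1"
    using exp_ge_add_one_self[of "- (2 * t)"] exp_ge_add_one_self[of "2 * t"] by linarith+
  then have 3: "(1 - exp (- (2 * t))) / K \<le> (exp (2 * t) - 1) / K"
    by (intro divide_right_mono) auto
  have 4: "(exp (2 * t) - 1) / K \<le> exp (2 * t) - 1"
    using divide_left_mono[of 1 K "exp (2 * t) - 1"] t K by simp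
  show ?thesis
    using order_trans[OF 1 4] order_trans[OF 2 order_trans[OF 3 4]] by (simp add: abs_le_iff)
qed

text \<open>The negative gradient of the loss with respect to the logits.\<close>

definition residual :: "nat \<Rightarrow> nat \<Rightarrow> (nat \<Rightarrow> nat \<Rightarrow> real) \<Rightarrow> nat \<Rightarrow> nat \<Rightarrow> real" where
  "residual K n Z c j = of_bool (c = j div n) - softmax K (\<lambda>k. Z k j) c"

lemma abs_residual_le: "c < K \<Longrightarrow> \<bar>residual K n Z c j\<bar> \<le> 1"
  using softmax_bounds[of c K "\<lambda>k. Z k j"] by (auto simp: residual_def of_bool_def)

lemma ce_loss_altdef:
  assumes "1 \<le> K"
  shows "ce_loss K n L d \<theta> = (\<Sum>j<n * K. ln (\<Sum>k<K. exp (logits L d \<theta> k j)) - logits L d \<theta> (j div n) j)"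
proof -
  have "0 < (\<Sum>k<K. exp (logits L d \<theta> k j))" for j
    using assms by (intro sum_pos) (auto simp: lessThan_empty_iff)
  then have "ln (exp x / (\<Sum>k<K. exp (logits L d \<theta> k j))) = x - ln (\<Sum>k<K. exp (logits L d \<theta> k j))" for x j
    by (simp add: ln_div less_imp_neq[symmetric])
  then show ?thesis
    unfolding ce_loss_def
    using sum_class_samples[of "\<lambda>c j. logits L d \<theta> c j - ln (\<Sum>k<K. exp (logits L d \<theta> k j))" n K]
    by (simp add: sum_negf[symmetric])
qed

text \<open>The logits turn out to be affine in each single parameter, so the partial derivatives of
  the loss only require its derivative along a line. Log-sum-exp differentiates to the softmax
  average of \<open>D\<close>.\<close>

lemma has_derivative_ce_of_affine:
  fixes Z D :: "nat \<Rightarrow> nat \<Rightarrow> real" and x :: real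
  assumes K: "1 \<le> K"
  defines "f \<equiv> \<lambda>s. \<lambda>k j. Z k j + (s - x) * D k j"
  shows "((\<lambda>s. \<Sum>j<n * K. ln (\<Sum>k<K. exp (f s k j)) - f s (j div n) j) has_real_derivative
    - (\<Sum>c<K. \<Sum>j<n * K. residual K n Z c j * D c j)) (at x)"
proof -
  have pos: "0 < (\<Sum>k<K. exp (Z k j))" for j
    using K by (intro sum_pos) (auto simp: lessThan_empty_iff)
  have "((\<lambda>s. \<Sum>j<n * K. ln (\<Sum>k<K. exp (f s k j)) - f s (j div n) j) has_real_derivative
    (\<Sum>j<n * K. (\<Sum>k<K. exp (Z k j) * D k j) / (\<Sum>k<K. exp (Z k j)) - D (j div n) j)) (at x)"
    unfolding f_def using pos
    by (auto intro!: derivative_eq_intros sum.cong simp: field_simps)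
  moreover have "(\<Sum>k<K. exp (Z k j) * D k j) / (\<Sum>k<K. exp (Z k j)) - D (j div n) j
      = - (\<Sum>c<K. residual K n Z c j * D c j)" if "j < n * K" for j
  proof -
    \<comment> \<open>The label must be a valid class for the indicator in the residual to pick out
      \<open>D (j div n) j\<close>.\<close>
    have "j div n < K"
      using that by (simp add: less_mult_imp_div_less mult.commute)
    then show ?thesis
      by (simp add: residual_def softmax_def left_diff_distrib sum_subtractf sum_divide_distrib
          of_bool_def if_distrib[of "\<lambda>x. x * _"] cong: if_cong)
  qed
  ultimately show ?thesis
    by (subst sum.swap) (simp add: sum_negf)
qed

section \<open>The network as forward and backward chains, and its tangent kernel\<close>

locale deep_ufm =
  fixes K n L d :: nat
  assumes K: "1 \<le> K" and n: "1 \<le> n" and L: "1 \<le> L" and d: "1 \<le> d"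
begin

abbreviation Nf :: "nat \<Rightarrow> nat" where "Nf s \<equiv> if s = 0 then n * K else d"
abbreviation Nb :: "nat \<Rightarrow> nat" where "Nb s \<equiv> if s = 0 then K else d"

text \<open>Column \<open>j\<close> of \<open>W\<^sub>s\<^sub>-\<^sub>1 \<cdots> W\<^sub>1 H\<^sub>1\<close> and row \<open>c\<close> of \<open>W\<^sub>L \<cdots> W\<^sub>L\<^sub>-\<^sub>s\<^sub>+\<^sub>1\<close> (unit vectors for \<open>s = 0\<close>).\<close>

abbreviation fchain :: "param \<Rightarrow> nat \<Rightarrow> nat \<Rightarrow> nat \<Rightarrow> real" where
  "fchain \<equiv> chain (\<lambda>s r c. (s, r, c)) Nf"
abbreviation bchain :: "param \<Rightarrow> nat \<Rightarrow> nat \<Rightarrow> nat \<Rightarrow> real" where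
  "bchain \<equiv> chain (\<lambda>s r c. (L - s, c, r)) Nb"
abbreviation fgram :: "param \<Rightarrow> nat \<Rightarrow> nat \<Rightarrow> nat \<Rightarrow> real" where
  "fgram \<equiv> gram (\<lambda>s r c. (s, r, c)) Nf"
abbreviation bgram :: "param \<Rightarrow> nat \<Rightarrow> nat \<Rightarrow> nat \<Rightarrow> real" where
  "bgram \<equiv> gram (\<lambda>s r c. (L - s, c, r)) Nb"

text \<open>The rows of layer \<open>l\<close> match the components of a backward chain of length
  \<open>L - l\<close>, its columns those of a forward chain of length \<open>l\<close>.
  \<open>L \<ge> 1\<close> keeps the first and the last layer apart.\<close>

lemma ufm_params_eq: "ufm_params K n L d = (SIGMA l:{..L}. {..<Nb (L - l)} \<times> {..<Nf l})"
  using L by (auto simp: ufm_params_def split: if_splits)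

text \<open>Stopping after \<open>L\<close> steps leaves out the output layer here and the
  transposed input layer in the backward direction; these have \<open>K\<close> and
  \<open>n * K\<close> rows, not \<open>d\<close>.\<close>

sublocale fwd: gaussian_chain "\<lambda>s r c. (s, r, c)" Nf "ufm_params K n L d" L d
  by unfold_locales (use d in \<open>auto simp: ufm_params_eq split: if_splits\<close>)

sublocale bwd: gaussian_chain "\<lambda>s r c. (L - s, c, r)" Nb "ufm_params K n L d" L d
  by unfold_locales (use d in \<open>auto simp: ufm_params_eq split: if_splits\<close>)

lemma gauss_init_eq: "gauss_init K n L d = PiM (ufm_params K n L d) (\<lambda>_. gaussian_entry d)"
  by (simp add: gauss_init_def gaussian_entry_def)

text \<open>The index shifts by one because a chain starts at a unit vector: its first step merely
  selects column \<open>j\<close> of layer 0.\<close>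

lemma hprod_eq_fchain:
  assumes "j < n * K"
  shows "hprod d \<theta> l a j = fchain \<theta> j (Suc l) a"
proof (induction l arbitrary: a)
  case 0
  then show ?case
    using assms by (simp add: of_bool_def if_distrib[of "\<lambda>x. _ * x"] cong: if_cong)
next
  case (Suc l)
  then show ?case by (simp del: chain.simps add: chain.simps(2)[of _ _ _ _ "Suc l"])
qed

lemma logits_eq_bchain:
  assumes c: "c < K" and "s \<le> L"
  shows "logits L d \<theta> c j = (\<Sum>a<Nb s. bchain \<theta> c s a * hprod d \<theta> (L - s) a j)"
  using \<open>s \<le> L\<close>
proof (induction s)
  case 0
  then show ?case
    using c by (simp add: logits_def of_bool_def if_distrib[of "\<lambda>x. x * _"] cong: if_cong)
next
  case (Suc s)
  then have L: "L - s = Suc (L - Suc s)" by simp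
  have "logits L d \<theta> c j = (\<Sum>a<Nb s. bchain \<theta> c s a * hprod d \<theta> (L - s) a j)"
    using Suc by simp
  also have "\<dots> = (\<Sum>a<Nb s. \<Sum>k<d. bchain \<theta> c s a * (\<theta> (L - s, a, k) * hprod d \<theta> (L - Suc s) k j))"
    unfolding L by (simp add: sum_distrib_left)
  also have "\<dots> = (\<Sum>k<d. \<Sum>a<Nb s. bchain \<theta> c s a * (\<theta> (L - s, a, k) * hprod d \<theta> (L - Suc s) k j))"
    by (rule sum.swap)
  also have "\<dots> = (\<Sum>k<d. bchain \<theta> c (Suc s) k * hprod d \<theta> (L - Suc s) k j)"
    unfolding chain.simps(2) sum_distrib_right by (intro sum.cong refl) (simp only: mult_ac)
  finally show ?case by simp
qed

text \<open>Cutting the product on both sides of layer \<open>l\<close> exposes each logit as linear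
  in the entries of that layer.\<close>

lemma logits_eq_bilinear:
  assumes "c < K" "j < n * K" "l \<le> L"
  shows "logits L d \<theta> c j
    = (\<Sum>a<Nb (L - l). \<Sum>b<Nf l. bchain \<theta> c (L - l) a * \<theta> (l, a, b) * fchain \<theta> j l b)"
  using logits_eq_bchain[OF assms(1), of "L - l" \<theta> j] assms
  by (simp add: hprod_eq_fchain[OF assms(2)] sum_distrib_left mult.assoc)

text \<open>The backward factor reads only layers above \<open>l\<close> and the forward factor only
  layers below it, so a single term of the double sum changes.\<close>

lemma logits_update:
  assumes cj: "c < K" "j < n * K" and p: "(l, a, b) \<in> ufm_params K n L d"
  shows "logits L d (\<theta>((l, a, b) := s)) c j
    = logits L d \<theta> c j + (s - \<theta> (l, a, b)) * (bchain \<theta> c (L - l) a * fchain \<theta> j l b)"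
proof -
  let ?\<theta> = "\<theta>((l, a, b) := s)"
  have l: "l \<le> L" and a: "a < Nb (L - l)" and b: "b < Nf l"
    using p by (auto simp: ufm_params_eq)
  have bc: "bchain ?\<theta> c (L - l) a' = bchain \<theta> c (L - l) a'" if "a' < Nb (L - l)" for a'
    using that by (intro chain_cong) auto
  have fc: "fchain ?\<theta> j l b' = fchain \<theta> j l b'" if "b' < Nf l" for b'
    using that by (intro chain_cong) auto
  have delta: "(\<Sum>a'<M. \<Sum>b'<N. if a' = a then if b' = b then v else 0 else 0) = v"
    if "a < M" "b < N" for M N :: nat and v :: real
  proof -
    have "(\<Sum>b'<N. if a' = a then if b' = b then v else 0 else 0) = (if a' = a then v else 0)" for a'
      using that by simp
    then show ?thesis using that by simp
  qed
  let ?A = "bchain \<theta> c (L - l)" and ?F = "fchain \<theta> j l"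
  have "logits L d ?\<theta> c j = (\<Sum>a'<Nb (L - l). \<Sum>b'<Nf l. ?A a' * ?\<theta> (l, a', b') * ?F b')"
    unfolding logits_eq_bilinear[OF cj l] by (intro sum.cong refl) (simp only: bc fc lessThan_iff)
  also have "\<dots> = (\<Sum>a'<Nb (L - l). \<Sum>b'<Nf l. ?A a' * \<theta> (l, a', b') * ?F b'
      + (if a' = a then if b' = b then (s - \<theta> (l, a, b)) * (?A a * ?F b) else 0 else 0))"
    by (intro sum.cong refl) (auto simp: algebra_simps)
  also have "\<dots> = logits L d \<theta> c j + (s - \<theta> (l, a, b)) * (?A a * ?F b)"
    unfolding logits_eq_bilinear[OF cj l, of \<theta>] sum.distrib
    by (simp only: delta[OF a b])
  finally show ?thesis .
qed

lemma pderiv_logits: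
  assumes "c < K" "j < n * K" "(l, a, b) \<in> ufm_params K n L d"
  shows "pderiv_at (\<lambda>\<theta>. logits L d \<theta> c j) \<theta> (l, a, b) = bchain \<theta> c (L - l) a * fchain \<theta> j l b"
  unfolding pderiv_at_def logits_update[OF assms]
  by (rule DERIV_imp_deriv) (auto intro!: derivative_eq_intros)

lemma pderiv_ce_loss:
  assumes p: "(l, a, b) \<in> ufm_params K n L d"
  shows "pderiv_at (ce_loss K n L d) \<theta> (l, a, b)
    = - (\<Sum>c<K. \<Sum>j<n * K. residual K n (logits L d \<theta>) c j * (bchain \<theta> c (L - l) a * fchain \<theta> j l b))"
proof -
  let ?x = "\<theta> (l, a, b)"
  let ?f = "\<lambda>s k j. logits L d \<theta> k j + (s - ?x) * (bchain \<theta> k (L - l) a * fchain \<theta> j l b)"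
  have "ce_loss K n L d (\<theta>((l, a, b) := s))
      = (\<Sum>j<n * K. ln (\<Sum>k<K. exp (?f s k j)) - ?f s (j div n) j)" for s
    unfolding ce_loss_altdef[OF K]
  proof (rule sum.cong[OF refl])
    fix j assume "j \<in> {..<n * K}"
    then have j: "j < n * K" "j div n < K"
      by (auto simp: less_mult_imp_div_less mult.commute)
    show "ln (\<Sum>k<K. exp (logits L d (\<theta>((l, a, b) := s)) k j)) - logits L d (\<theta>((l, a, b) := s)) (j div n) j
        = ln (\<Sum>k<K. exp (?f s k j)) - ?f s (j div n) j"
      using logits_update[OF _ j(1) p, of _ \<theta> s] j(2) by simp
  qed
  then show ?thesis
    unfolding pderiv_at_def
    using has_derivative_ce_of_affine[OF K, where Z = "logits L d \<theta>" and x = ?x and n = n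
        and D = "\<lambda>k j. bchain \<theta> k (L - l) a * fchain \<theta> j l b", THEN DERIV_imp_deriv]
    by simp
qed

text \<open>The gradient of a logit with respect to layer \<open>l\<close> is the outer product of a
  backward and a forward vector, so the inner product of two such gradients is a product of two Gram
  entries. The sign of the flow cancels that of the loss gradient.\<close>

lemma Zdot0_eq_gram:
  assumes cj: "c < K" "j < n * K"
  shows "Zdot0 K n L d \<theta> c j = (\<Sum>l\<le>L. \<Sum>c'<K. \<Sum>j'<n * K.
    bgram \<theta> (L - l) c c' * fgram \<theta> l j j' * residual K n (logits L d \<theta>) c' j')"
proof -
  let ?R = "residual K n (logits L d \<theta>)"
  let ?D = "\<lambda>c j l a b. bchain \<theta> c (L - l) a * fchain \<theta> j l b"
  have "Zdot0 K n L d \<theta> c j = (\<Sum>(l, a, b)\<in>ufm_params K n L d.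
      ?D c j l a b * (\<Sum>c'<K. \<Sum>j'<n * K. ?R c' j' * ?D c' j' l a b))"
    unfolding Zdot0_def
    by (intro sum.cong refl) (auto simp: pderiv_logits[OF cj] pderiv_ce_loss)
  also have "\<dots> = (\<Sum>l\<le>L. \<Sum>(a, b)\<in>{..<Nb (L - l)} \<times> {..<Nf l}.
      ?D c j l a b * (\<Sum>c'<K. \<Sum>j'<n * K. ?R c' j' * ?D c' j' l a b))"
    unfolding ufm_params_eq by (subst sum.Sigma) (auto simp: case_prod_unfold)
  also have "\<dots> = (\<Sum>l\<le>L. \<Sum>c'<K. \<Sum>j'<n * K. bgram \<theta> (L - l) c c' * fgram \<theta> l j j' * ?R c' j')"
  proof (rule sum.cong[OF refl])
    fix l
    let ?S = "{..<Nb (L - l)} \<times> {..<Nf l}"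
    have "(\<Sum>(a, b)\<in>?S. ?D c j l a b * (\<Sum>c'<K. \<Sum>j'<n * K. ?R c' j' * ?D c' j' l a b))
        = (\<Sum>x\<in>?S. \<Sum>c'<K. \<Sum>j'<n * K. case x of (a, b) \<Rightarrow> ?D c j l a b * ?D c' j' l a b * ?R c' j')"
      by (intro sum.cong refl) (auto simp: sum_distrib_left algebra_simps)
    also have "\<dots> = (\<Sum>c'<K. \<Sum>j'<n * K. \<Sum>x\<in>?S. case x of (a, b) \<Rightarrow> ?D c j l a b * ?D c' j' l a b * ?R c' j')"
      by (subst sum.swap, intro sum.cong refl) (rule sum.swap)
    also have "\<dots> = (\<Sum>c'<K. \<Sum>j'<n * K. bgram \<theta> (L - l) c c' * fgram \<theta> l j j' * ?R c' j')"
    proof (intro sum.cong refl)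
      fix c' j'
      have "(\<Sum>x\<in>?S. case x of (a, b) \<Rightarrow> ?D c j l a b * ?D c' j' l a b * ?R c' j')
          = (\<Sum>a<Nb (L - l). \<Sum>b<Nf l. ?D c j l a b * ?D c' j' l a b * ?R c' j')"
        by (rule sum.cartesian_product[symmetric])
      also have "\<dots> = bgram \<theta> (L - l) c c' * fgram \<theta> l j j' * ?R c' j'"
        unfolding gram_def unfolding sum_product unfolding sum_distrib_right
        by (intro sum.cong refl) (simp only: mult_ac)
      finally show "(\<Sum>x\<in>?S. case x of (a, b) \<Rightarrow> ?D c j l a b * ?D c' j' l a b * ?R c' j')
          = bgram \<theta> (L - l) c c' * fgram \<theta> l j j' * ?R c' j'" .
    qed
    finally show "(\<Sum>(a, b)\<in>?S. ?D c j l a b * (\<Sum>c'<K. \<Sum>j'<n * K. ?R c' j' * ?D c' j' l a b))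
        = (\<Sum>c'<K. \<Sum>j'<n * K. bgram \<theta> (L - l) c c' * fgram \<theta> l j j' * ?R c' j')" .
  qed
  finally show ?thesis .
qed

section \<open>Scaling by the initialization size and the deviation on the good event\<close>

lemma logits_scale:
  assumes "j < n * K"
  shows "logits L d (\<lambda>p. a * \<theta> p) c j = a ^ Suc L * logits L d \<theta> c j"
  unfolding logits_def hprod_eq_fchain[OF assms] by (rule chain_scale)

text \<open>Layer \<open>l\<close> contributes \<open>\<epsilon> ^ (2 * (L - l))\<close> from the
  backward and \<open>\<epsilon> ^ (2 * l)\<close> from the forward Gram matrix, the same power for
  every layer.\<close>

lemma Zdot0_scaled:
  assumes cj: "c < K" "j < n * K"
  shows "Zdot0 K n L d (\<lambda>p. \<epsilon> * B p) c j = \<epsilon> ^ (2 * L) * (\<Sum>l\<le>L. \<Sum>c'<K. \<Sum>j'<n * K.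
    bgram B (L - l) c c' * fgram B l j j' * residual K n (\<lambda>k i. \<epsilon> ^ Suc L * logits L d B k i) c' j')"
proof -
  have R: "residual K n (logits L d (\<lambda>p. \<epsilon> * B p)) c' j'
      = residual K n (\<lambda>k i. \<epsilon> ^ Suc L * logits L d B k i) c' j'" if "j' < n * K" for c' j'
    by (simp only: residual_def logits_scale[OF that])
  have "\<epsilon> ^ (2 * L) = \<epsilon> ^ (2 * (L - l)) * \<epsilon> ^ (2 * l)" if "l \<le> L" for l
    using that by (simp flip: power_add distrib_left)
  then show ?thesis
    unfolding Zdot0_eq_gram[OF cj] gram_scale sum_distrib_left
    by (intro sum.cong refl) (simp add: R)
qed

text \<open>The cut directly above layer 0 gives two vectors of length \<open>d\<close> whose Gram
  matrices are both covered by the concentration bound.\<close>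

lemma logits_eq_inner:
  assumes "c < K" "j < n * K"
  shows "logits L d B c j = (\<Sum>a<d. bchain B c L a * fchain B j 1 a)"
  using logits_eq_bchain[OF assms(1), of L B j] L hprod_eq_fchain[OF assms(2), of B 0]
  by (simp del: chain.simps)

lemma abs_logits_le:
  assumes "c < K" "j < n * K"
  shows "\<bar>logits L d B c j\<bar> \<le> (bgram B L c c + fgram B 1 j j) / 2"
proof -
  have "\<bar>logits L d B c j\<bar> \<le> (\<Sum>a<d. \<bar>bchain B c L a * fchain B j 1 a\<bar>)"
    unfolding logits_eq_inner[OF assms] by (rule sum_abs)
  also have "\<dots> \<le> (\<Sum>a<d. (bchain B c L a * bchain B c L a + fchain B j 1 a * fchain B j 1 a) / 2)"
  proof (rule sum_mono)
    fix a
    show "\<bar>bchain B c L a * fchain B j 1 a\<bar>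
        \<le> (bchain B c L a * bchain B c L a + fchain B j 1 a * fchain B j 1 a) / 2"
      using sum_squares_bound[of "\<bar>bchain B c L a\<bar>" "\<bar>fchain B j 1 a\<bar>"]
      by (simp add: abs_mult power2_eq_square del: chain.simps)
  qed
  also have "\<dots> = (bgram B L c c + fgram B 1 j j) / 2"
    using L by (simp add: gram_def sum.distrib sum_divide_distrib[symmetric] del: chain.simps)
  finally show ?thesis .
qed

text \<open>The deterministic part. Each of the \<open>L + 1\<close> layers errs by at most
  \<open>3 * \<delta>\<close> for each of the \<open>K * (n * K)\<close> kernel entries, as
  residuals are bounded by 1, and by the distance of the residual from
  \<open>S_kron\<close>.\<close>

lemma Zdot0_near:
  assumes cj: "c < K" "j < n * K" and \<epsilon>: "0 < \<epsilon>" "\<epsilon> \<le> 1" and \<delta>: "0 < \<delta>" "\<delta> \<le> 1"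
    and b: "\<And>s i k. s \<le> L \<Longrightarrow> i < K \<Longrightarrow> k < K \<Longrightarrow> \<bar>bgram B s i k - of_bool (i = k)\<bar> \<le> \<delta>"
    and f: "\<And>s i k. s \<le> L \<Longrightarrow> i < n * K \<Longrightarrow> k < n * K \<Longrightarrow> \<bar>fgram B s i k - of_bool (i = k)\<bar> \<le> \<delta>"
  shows "\<bar>Zdot0 K n L d (\<lambda>p. \<epsilon> * B p) c j / \<epsilon> ^ (2 * L) - real (L + 1) * S_kron K n c j\<bar>
    \<le> real (L + 1) * (real K * real (n * K) * (3 * \<delta>) + (exp (4 * \<epsilon>) - 1))"
proof -
  define Z where "Z = (\<lambda>k i. \<epsilon> ^ Suc L * logits L d B k i)"
  define R where "R = residual K n Z"
  have Z: "\<bar>Z k i\<bar> \<le> 2 * \<epsilon>" if "k < K" "i < n * K" for k i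
  proof -
    \<comment> \<open>Since \<open>\<delta> \<le> 1\<close>, the diagonal Gram entries are at most
      2, hence so are the logits at \<open>B\<close>.\<close>
    have "bgram B L k k \<le> 2" "fgram B 1 i i \<le> 2"
      using b[of L k k] f[of 1 i i] that L \<delta> by auto
    then have "(bgram B L k k + fgram B 1 i i) / 2 \<le> (2 + 2) / 2"
      by (intro divide_right_mono add_mono) auto
    also have "(2 + 2) / 2 = (2 :: real)" by simp
    finally have "\<bar>logits L d B k i\<bar> \<le> 2"
      by (rule order_trans[OF abs_logits_le[OF that]])
    moreover have "\<epsilon> ^ Suc L \<le> \<epsilon>"
      using \<epsilon> power_decreasing[of 1 "Suc L" \<epsilon>] by simp
    ultimately have "\<epsilon> ^ Suc L * \<bar>logits L d B k i\<bar> \<le> \<epsilon> * 2"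
      using \<epsilon> by (intro mult_mono) auto
    then show ?thesis
      using \<epsilon> by (simp add: Z_def abs_mult)
  qed
  \<comment> \<open>The indicators cancel, leaving the distance of the softmax from uniform for
    logits bounded by \<open>2 * \<epsilon>\<close>.\<close>
  have RS: "\<bar>R c j - S_kron K n c j\<bar> \<le> exp (4 * \<epsilon>) - 1"
    using softmax_near_uniform[OF K cj(1), of "2 * \<epsilon>" "\<lambda>k. Z k j"] Z cj \<epsilon>
    by (auto simp: R_def residual_def S_kron_def)
  have layer: "\<bar>(\<Sum>c'<K. \<Sum>j'<n * K. bgram B (L - l) c c' * fgram B l j j' * R c' j') - S_kron K n c j\<bar>
      \<le> real K * real (n * K) * (3 * \<delta>) + (exp (4 * \<epsilon>) - 1)" if l: "l \<le> L" for l
  proof -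
    let ?E = "\<lambda>c' j'. (bgram B (L - l) c c' * fgram B l j j' - of_bool (c = c') * of_bool (j = j')) * R c' j'"
    have E: "\<bar>?E c' j'\<bar> \<le> 3 * \<delta>" if "c' < K" "j' < n * K" for c' j'
    proof -
      define x where "x = bgram B (L - l) c c' - of_bool (c = c')"
      define y where "y = fgram B l j j' - of_bool (j = j')"
      have x: "\<bar>x\<bar> \<le> \<delta>" and y: "\<bar>y\<bar> \<le> \<delta>"
        using b[of "L - l" c c'] f[of l j j'] l that cj by (auto simp: x_def y_def)
      \<comment> \<open>Expanding the product around the two identity entries;
        \<open>\<delta> \<le> 1\<close> makes the quadratic term \<open>x * y\<close> at most
        \<open>\<delta>\<close>, whence the factor 3.\<close>
      have "bgram B (L - l) c c' * fgram B l j j' - of_bool (c = c') * of_bool (j = j')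
          = x * y + of_bool (c = c') * y + x * of_bool (j = j')"
        by (simp add: x_def y_def algebra_simps)
      also have "\<bar>\<dots>\<bar> \<le> \<bar>x\<bar> * \<bar>y\<bar> + \<bar>y\<bar> + \<bar>x\<bar>"
        by (auto simp: of_bool_def abs_mult[symmetric])
      also have "\<dots> \<le> 1 * \<delta> + \<delta> + \<delta>"
        using x y \<delta> by (intro add_mono mult_mono) auto
      finally have "\<bar>bgram B (L - l) c c' * fgram B l j j' - of_bool (c = c') * of_bool (j = j')\<bar> \<le> 3 * \<delta>"
        by simp
      moreover have "\<bar>R c' j'\<bar> \<le> 1"
        unfolding R_def by (rule abs_residual_le[OF that(1)])
      ultimately have "\<bar>?E c' j'\<bar> \<le> 3 * \<delta> * 1"
        unfolding abs_mult[of _ "R c' j'"] using \<delta> by (intro mult_mono) auto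
      then show ?thesis by (simp only: mult_1_right)
    qed
    \<comment> \<open>The identity kernel returns the residual at \<open>(c, j)\<close>.\<close>
    have "(\<Sum>c'<K. \<Sum>j'<n * K. of_bool (c = c') * of_bool (j = j') * R c' j') = R c j"
    proof -
      have "of_bool (c = c') * of_bool (j = j') * R c' j'
          = (if j = j' then if c = c' then R c' j' else 0 else 0)" for c' j'
        by simp
      then show ?thesis
        using cj by (simp only: sum.delta sum.delta' finite_lessThan lessThan_iff if_True)
    qed
    then have eq: "(\<Sum>c'<K. \<Sum>j'<n * K. bgram B (L - l) c c' * fgram B l j j' * R c' j')
        = (\<Sum>c'<K. \<Sum>j'<n * K. ?E c' j') + R c j"
      by (simp only: left_diff_distrib sum_subtractf)
    have "\<bar>\<Sum>c'<K. \<Sum>j'<n * K. ?E c' j'\<bar> \<le> (\<Sum>c'<K. \<Sum>j'<n * K. \<bar>?E c' j'\<bar>)"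
      by (intro order_trans[OF sum_abs] sum_mono sum_abs)
    also have "\<dots> \<le> (\<Sum>c'<K. \<Sum>j'<n * K. 3 * \<delta>)"
      using E by (intro sum_mono) auto
    also have "\<dots> = real K * real (n * K) * (3 * \<delta>)"
      by simp
    finally show ?thesis
      unfolding eq using RS by linarith
  qed
  let ?T = "\<lambda>l. (\<Sum>c'<K. \<Sum>j'<n * K. bgram B (L - l) c c' * fgram B l j j' * R c' j') - S_kron K n c j"
  have eq: "Zdot0 K n L d (\<lambda>p. \<epsilon> * B p) c j / \<epsilon> ^ (2 * L) - real (L + 1) * S_kron K n c j = (\<Sum>l\<le>L. ?T l)"
    unfolding Zdot0_scaled[OF cj] R_def Z_def sum_subtractf using \<epsilon> by simp
  have "\<bar>\<Sum>l\<le>L. ?T l\<bar> \<le> (\<Sum>l\<le>L. \<bar>?T l\<bar>)"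
    by (rule sum_abs)
  also have "\<dots> \<le> (\<Sum>l\<le>L. real K * real (n * K) * (3 * \<delta>) + (exp (4 * \<epsilon>) - 1))"
    by (rule sum_mono, rule layer) (simp only: atMost_iff)
  also have "\<dots> = real (L + 1) * (real K * real (n * K) * (3 * \<delta>) + (exp (4 * \<epsilon>) - 1))"
    by (simp only: sum_constant card_atMost Suc_eq_plus1)
  finally show ?thesis unfolding eq .
qed

section \<open>Measurability and probability of the deviation event\<close>

lemma sets_dev_event: "dev_event K n L d \<epsilon> \<eta> \<in> sets (gauss_init K n L d)"
proof -
  let ?P = "gauss_init K n L d"
  have bg [measurable]: "(\<lambda>B. bgram B s i k) \<in> borel_measurable ?P" if "s \<le> L" for s i k
    unfolding gauss_init_eq using that bwd.p_in by (intro bwd.borel_measurable_gram) auto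
  have fg [measurable]: "(\<lambda>B. fgram B s i k) \<in> borel_measurable ?P" if "s \<le> L" for s i k
    unfolding gauss_init_eq using that fwd.p_in by (intro fwd.borel_measurable_gram) auto
  have lg: "(\<lambda>B. logits L d B k i) \<in> borel_measurable ?P" if "k < K" "i < n * K" for k i
    unfolding logits_eq_inner[OF that] gauss_init_eq using L bwd.p_in fwd.p_in
    by (intro borel_measurable_sum borel_measurable_times bwd.borel_measurable_chain
        fwd.borel_measurable_chain) auto
  have res: "(\<lambda>B. residual K n (\<lambda>k i. \<epsilon> ^ Suc L * logits L d B k i) c j) \<in> borel_measurable ?P"
    if "c < K" "j < n * K" for c j
    unfolding residual_def softmax_def
    by (intro borel_measurable_diff borel_measurable_const borel_measurable_divide
        measurable_compose[OF _ borel_measurable_exp] borel_measurable_sum borel_measurable_times lg) (use that in auto)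
  \<comment> \<open>The kernel formula replaces the derivatives by finite sums and products of
    measurable functions of the coordinates.\<close>
  have Zd: "(\<lambda>B. Zdot0 K n L d (\<lambda>p. \<epsilon> * B p) c j) \<in> borel_measurable ?P" if "c < K" "j < n * K" for c j
    unfolding Zdot0_scaled[OF that]
    by (intro borel_measurable_times borel_measurable_const borel_measurable_sum bg fg res) auto
  have "dev_event K n L d \<epsilon> \<eta> = (\<Union>c<K. \<Union>j<n * K. {B \<in> space ?P.
      \<bar>Zdot0 K n L d (\<lambda>p. \<epsilon> * B p) c j / \<epsilon> ^ (2*L) - real (L+1) * S_kron K n c j\<bar> > \<eta>})"
    by (auto simp: dev_event_def)
  also have "\<dots> \<in> sets ?P"
  proof (intro sets.finite_UN finite_lessThan)
    fix c j assume "c \<in> {..<K}" "j \<in> {..<n * K}"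
    then have [measurable]: "(\<lambda>B. Zdot0 K n L d (\<lambda>p. \<epsilon> * B p) c j) \<in> borel_measurable ?P"
      by (intro Zd) auto
    show "{B \<in> space ?P. \<bar>Zdot0 K n L d (\<lambda>p. \<epsilon> * B p) c j / \<epsilon> ^ (2*L)
        - real (L+1) * S_kron K n c j\<bar> > \<eta>} \<in> sets ?P"
      by measurable
  qed
  finally show ?thesis .
qed

text \<open>A union bound over the \<open>(L + 1) * (K^2 + (n * K)^2)\<close> Gram entries. Outside
  these exceptional events the deterministic estimate rules out a deviation above
  \<open>\<eta>\<close>.\<close>

lemma measure_dev_event_le:
  assumes \<epsilon>: "0 < \<epsilon>" "\<epsilon> \<le> 1" and \<delta>: "0 < \<delta>" "\<delta> \<le> 1"
    and \<eta>: "real (L + 1) * (real K * real (n * K) * (3 * \<delta>) + (exp (4 * \<epsilon>) - 1)) \<le> \<eta>"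
  shows "measure (gauss_init K n L d) (dev_event K n L d \<epsilon> \<eta>)
    \<le> real (L + 1) * (K\<^sup>2 + (n * K)\<^sup>2) * 8 ^ L / \<delta>\<^sup>2 / d"
proof -
  let ?P = "gauss_init K n L d"
  interpret P: prob_space ?P
    unfolding gauss_init_eq by (rule fwd.prob_space_PiM_G)
  define Tb where "Tb = {..L} \<times> {..<K} \<times> {..<K}"
  define Tf where "Tf = {..L} \<times> {..<n * K} \<times> {..<n * K}"
  define Ab where "Ab = (\<lambda>(s, i, k). {B \<in> space ?P. \<bar>bgram B s i k - of_bool (i = k)\<bar> > \<delta>})"
  define Af where "Af = (\<lambda>(s, i, k). {B \<in> space ?P. \<bar>fgram B s i k - of_bool (i = k)\<bar> > \<delta>})"
  have fin: "finite Tb" "finite Tf"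
    by (auto simp: Tb_def Tf_def)
  have mono: "8 ^ s / (real d * \<delta>\<^sup>2) \<le> 8 ^ L / (real d * \<delta>\<^sup>2)" if "s \<le> L" for s
    using that by (intro divide_right_mono power_increasing) auto
  have Ab: "Ab t \<in> sets ?P" "measure ?P (Ab t) \<le> 8 ^ L / (d * \<delta>\<^sup>2)" if T: "t \<in> Tb" for t
  proof -
    obtain s i k where t: "t = (s, i, k)" "s \<le> L" "i < K" "k < K"
      using T by (auto simp: Tb_def)
    show "Ab t \<in> sets ?P"
      unfolding Ab_def t(1) gauss_init_eq prod.case
      by (rule bwd.gram_concentration(1)) (use t \<delta> in auto)
    show "measure ?P (Ab t) \<le> 8 ^ L / (d * \<delta>\<^sup>2)"
      unfolding Ab_def t(1) gauss_init_eq prod.case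
      by (rule order_trans[OF bwd.gram_concentration(2) mono]) (use t \<delta> in auto)
  qed
  have Af: "Af t \<in> sets ?P" "measure ?P (Af t) \<le> 8 ^ L / (d * \<delta>\<^sup>2)" if T: "t \<in> Tf" for t
  proof -
    obtain s i k where t: "t = (s, i, k)" "s \<le> L" "i < n * K" "k < n * K"
      using T by (auto simp: Tf_def)
    show "Af t \<in> sets ?P"
      unfolding Af_def t(1) gauss_init_eq prod.case
      by (rule fwd.gram_concentration(1)) (use t \<delta> in auto)
    show "measure ?P (Af t) \<le> 8 ^ L / (d * \<delta>\<^sup>2)"
      unfolding Af_def t(1) gauss_init_eq prod.case
      by (rule order_trans[OF fwd.gram_concentration(2) mono]) (use t \<delta> in auto)
  qed
  have "dev_event K n L d \<epsilon> \<eta> \<subseteq> (\<Union>t\<in>Tb. Ab t) \<union> (\<Union>t\<in>Tf. Af t)"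
  proof
    fix B assume B: "B \<in> dev_event K n L d \<epsilon> \<eta>"
    then have sp: "B \<in> space ?P" by (simp add: dev_event_def)
    show "B \<in> (\<Union>t\<in>Tb. Ab t) \<union> (\<Union>t\<in>Tf. Af t)"
    proof (rule ccontr)
      assume out: "\<not> ?thesis"
      have b: "\<bar>bgram B s i k - of_bool (i = k)\<bar> \<le> \<delta>" if "s \<le> L" "i < K" "k < K" for s i k
      proof -
        have "(s, i, k) \<in> Tb" using that by (simp add: Tb_def)
        then have "B \<notin> Ab (s, i, k)" using out by blast
        then show ?thesis using sp by (simp add: Ab_def)
      qed
      have f: "\<bar>fgram B s i k - of_bool (i = k)\<bar> \<le> \<delta>" if "s \<le> L" "i < n * K" "k < n * K" for s i k
      proof -
        have "(s, i, k) \<in> Tf" using that by (simp add: Tf_def)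
        then have "B \<notin> Af (s, i, k)" using out by blast
        then show ?thesis using sp by (simp add: Af_def)
      qed
      from B obtain c j where cj: "c < K" "j < n * K" and
        gt: "\<bar>Zdot0 K n L d (\<lambda>p. \<epsilon> * B p) c j / \<epsilon> ^ (2 * L) - real (L + 1) * S_kron K n c j\<bar> > \<eta>"
        by (auto simp: dev_event_def)
      show False
        using Zdot0_near[OF cj \<epsilon> \<delta> b f] gt \<eta> by linarith
    qed
  qed
  then have "measure ?P (dev_event K n L d \<epsilon> \<eta>) \<le> measure ?P ((\<Union>t\<in>Tb. Ab t) \<union> (\<Union>t\<in>Tf. Af t))"
    using Ab(1) Af(1) fin by (intro P.finite_measure_mono) auto
  also have "\<dots> \<le> measure ?P (\<Union>t\<in>Tb. Ab t) + measure ?P (\<Union>t\<in>Tf. Af t)"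
    using Ab(1) Af(1) fin by (intro measure_Un_le) auto
  also have "\<dots> \<le> (\<Sum>t\<in>Tb. measure ?P (Ab t)) + (\<Sum>t\<in>Tf. measure ?P (Af t))"
    using Ab(1) Af(1) fin by (intro add_mono measure_UNION_le) auto
  also have "\<dots> \<le> (\<Sum>t\<in>Tb. 8 ^ L / (d * \<delta>\<^sup>2)) + (\<Sum>t\<in>Tf. 8 ^ L / (d * \<delta>\<^sup>2))"
    using Ab(2) Af(2) by (intro add_mono sum_mono) auto
  also have "\<dots> = real (L + 1) * (K\<^sup>2 + (n * K)\<^sup>2) * 8 ^ L / \<delta>\<^sup>2 / d"
    by (simp add: Tb_def Tf_def card_cartesian_product power2_eq_square field_simps add_divide_distrib)
  finally show ?thesis .
qed

end

section \<open>The joint limit of vanishing initialization and infinite width\<close>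

theorem theorem4p5:
  fixes K n L :: nat
  assumes "K \<ge> 2" and "n \<ge> 1" and "L \<ge> 1"
  shows "(\<forall>\<eta>>0. \<forall>\<epsilon>>0. \<forall>d\<ge>1. dev_event K n L d \<epsilon> \<eta> \<in> sets (gauss_init K n L d))
       \<and> (\<forall>\<eta>>0. ((\<lambda>(\<epsilon>, d). measure (gauss_init K n L d) (dev_event K n L d \<epsilon> \<eta>))
                   \<longlongrightarrow> 0) (at_right 0 \<times>\<^sub>F sequentially))"
proof (intro conjI allI impI)
  have ufm: "deep_ufm K n L d" if "d \<ge> 1" for d
    using assms that by unfold_locales auto
  show "dev_event K n L d \<epsilon> \<eta> \<in> sets (gauss_init K n L d)" if "d \<ge> 1" for \<eta> \<epsilon> :: real and d
    by (rule deep_ufm.sets_dev_event[OF ufm[OF that]])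
  fix \<eta> :: real assume \<eta>: "\<eta> > 0"
  define A where "A = real (L + 1) * (real K * real (n * K) * 3)"
  have A: "A > 0"
    using assms by (simp add: A_def)
  \<comment> \<open>Half of \<open>\<eta>\<close> is allotted to the kernel error
    \<open>A * \<delta>\<close>. The choice involves neither \<open>\<epsilon>\<close> nor
    \<open>d\<close>, so \<open>C\<close> below is a constant.\<close>
  define \<delta> where "\<delta> = min 1 (\<eta> / (2 * A))"
  have \<delta>: "0 < \<delta>" "\<delta> \<le> 1" and A\<delta>: "A * \<delta> \<le> \<eta> / 2"
    using \<eta> A by (auto simp: \<delta>_def min_def field_simps)
  define C where "C = real (L + 1) * (K\<^sup>2 + (n * K)\<^sup>2) * 8 ^ L / \<delta>\<^sup>2"
  \<comment> \<open>The other half of \<open>\<eta>\<close> covers the softmax error, by continuity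
    of \<open>exp\<close> at 0.\<close>
  have "((\<lambda>\<epsilon>. real (L + 1) * (exp (4 * \<epsilon>) - 1)) \<longlongrightarrow> real (L + 1) * (exp (4 * 0) - 1)) (at_right 0)"
    by (intro tendsto_intros)
  then have "eventually (\<lambda>\<epsilon>. real (L + 1) * (exp (4 * \<epsilon>) - 1) < \<eta> / 2) (at_right 0)"
    using \<eta> by (intro order_tendstoD(2)) auto
  moreover have "eventually (\<lambda>\<epsilon>. \<epsilon> \<in> {0<..<1}) (at_right (0::real))"
    by (rule eventually_at_right_real) simp
  ultimately have ev1: "eventually (\<lambda>\<epsilon>. 0 < \<epsilon> \<and> \<epsilon> \<le> 1 \<and> real (L + 1) * (exp (4 * \<epsilon>) - 1) \<le> \<eta> / 2) (at_right 0)"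
    by eventually_elim auto
  \<comment> \<open>The conditions on \<open>\<epsilon>\<close> and on \<open>d\<close> are
    separate, so the bound holds on a rectangle of the product filter and no relative rate is
    imposed.\<close>
  have bound: "eventually (\<lambda>x. (case x of (\<epsilon>, d) \<Rightarrow> measure (gauss_init K n L d) (dev_event K n L d \<epsilon> \<eta>))
      \<le> C / real (snd x)) (at_right 0 \<times>\<^sub>F sequentially)"
    unfolding eventually_prod_filter
  proof (intro exI conjI allI impI)
    show "eventually (\<lambda>\<epsilon>. 0 < \<epsilon> \<and> \<epsilon> \<le> 1 \<and> real (L + 1) * (exp (4 * \<epsilon>) - 1) \<le> \<eta> / 2) (at_right 0)"
      by (rule ev1)
    show "eventually (\<lambda>d. 1 \<le> d) sequentially"
      by (rule eventually_ge_at_top)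
    fix \<epsilon> :: real and d :: nat
    assume e: "0 < \<epsilon> \<and> \<epsilon> \<le> 1 \<and> real (L + 1) * (exp (4 * \<epsilon>) - 1) \<le> \<eta> / 2" and d: "1 \<le> d"
    have "real (L + 1) * (real K * real (n * K) * (3 * \<delta>) + (exp (4 * \<epsilon>) - 1))
        = A * \<delta> + real (L + 1) * (exp (4 * \<epsilon>) - 1)"
      by (simp add: A_def algebra_simps)
    also have "\<dots> \<le> \<eta>"
      using A\<delta> e by linarith
    finally show "(case (\<epsilon>, d) of (\<epsilon>, d) \<Rightarrow> measure (gauss_init K n L d) (dev_event K n L d \<epsilon> \<eta>))
        \<le> C / real (snd (\<epsilon>, d))"
      using deep_ufm.measure_dev_event_le[OF ufm[OF d] _ _ \<delta>] e by (simp add: C_def)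
  qed
  have lim: "((\<lambda>x. C / real (snd x)) \<longlongrightarrow> 0) (at_right (0::real) \<times>\<^sub>F sequentially)"
    by (rule filterlim_compose[OF lim_const_over_n filterlim_snd])
  show "((\<lambda>(\<epsilon>, d). measure (gauss_init K n L d) (dev_event K n L d \<epsilon> \<eta>)) \<longlongrightarrow> 0)
      (at_right 0 \<times>\<^sub>F sequentially)"
    by (rule tendsto_sandwich[OF _ bound tendsto_const lim]) (auto simp: case_prod_unfold)
qed

end
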